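(* Let $\Bbbk$ be a field, let $\Delta$ be a finite simplicial complex on $[m]=\{1,\dots,m\}$ without ghost vertices, let $n_1,\dots,n_m\ge 2$ be integers, and put $A=\Bbbk[x_1,\dots,x_m]/\bigl(I_\Delta+(x_1^{n_1},\dots,x_m^{n_m})\bigr)$. If $\Delta$ is flag, then $$\operatorname{tr}_A(\omega_A)=(x_F:F\in\Delta\text{ is a free face})A.$$
   Context: A simplicial complex $\Delta$ on $[m]$ is a set of subsets (faces) of $[m]$ closed under taking subsets and containing $\varnothing$. A vertex $i$ is a ghost vertex if $\{i\}\notin\Delta$. Facets are maximal faces. A face (possibly empty) is free if it is contained in a unique facet; in particular every facet is free. For $F\subseteq[m]$ put $x_F=\prod_{i\in F}x_i$ (so $x_\varnothing=1$); $I_\Delta=(x_F: F\subseteq[m],\ F\notin\Delta)$ is the Stanley--Reisner ideal. The $1$-skeleton $\Delta^{(1)}$ is the graph on the non-ghost vertices whose edges are the two-element faces; $\Delta$ is flag if every clique of $\Delta^{(1)}$ is a face of $\Delta$. For an Artinian positively graded $\Bbbk$-algebra $A$ (with $A_0=\Bbbk$), the canonical module is $\omega_A=\operatorname{Hom}_{\Bbbk}(A,\Bbbk)$ with $(a\lambda)(b)=\lambda(ab)$, and the canonical trace is the ideal $\operatorname{tr}_A(\omega_A)=\sum_{\varphi\in\operatorname{Hom}_A(\omega_A,A)}\varphi(\omega_A)$. *)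

theory Defs
  imports
    "HOL-Algebra.Algebra"
    "HOL-Algebra.Algebraic_Closure_Type"
    "HOL-Library.Poly_Mapping"
begin

section \<open>Simplicial complexes\<close>

definition simplicial_complex_on :: "'v set \<Rightarrow> 'v set set \<Rightarrow> bool" where
  "simplicial_complex_on V \<Delta> \<longleftrightarrow>
     \<Delta> \<subseteq> Pow V \<and> {} \<in> \<Delta> \<and> (\<forall>F\<in>\<Delta>. \<forall>G. G \<subseteq> F \<longrightarrow> G \<in> \<Delta>)"

definition ghost_vertex :: "'v set set \<Rightarrow> 'v \<Rightarrow> bool" where
  "ghost_vertex \<Delta> i \<longleftrightarrow> {i} \<notin> \<Delta>"

definition facet :: "'v set set \<Rightarrow> 'v set \<Rightarrow> bool" where
  "facet \<Delta> F \<longleftrightarrow> F \<in> \<Delta> \<and> (\<forall>G\<in>\<Delta>. F \<subseteq> G \<longrightarrow> G = F)"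

definition free_face :: "'v set set \<Rightarrow> 'v set \<Rightarrow> bool" where
  "free_face \<Delta> F \<longleftrightarrow> F \<in> \<Delta> \<and> (\<exists>!G. facet \<Delta> G \<and> F \<subseteq> G)"

definition skeleton_vertices :: "'v set \<Rightarrow> 'v set set \<Rightarrow> 'v set" where
  "skeleton_vertices V \<Delta> = {i \<in> V. \<not> ghost_vertex \<Delta> i}"

definition skeleton_edges :: "'v set set \<Rightarrow> 'v set set" where
  "skeleton_edges \<Delta> = {e \<in> \<Delta>. card e = 2}"

definition clique_in :: "'v set \<Rightarrow> 'v set set \<Rightarrow> 'v set \<Rightarrow> bool" where
  "clique_in W E C \<longleftrightarrow> C \<subseteq> W \<and> (\<forall>i\<in>C. \<forall>j\<in>C. i \<noteq> j \<longrightarrow> {i, j} \<in> E)"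

definition flag_complex :: "'v set \<Rightarrow> 'v set set \<Rightarrow> bool" where
  "flag_complex V \<Delta> \<longleftrightarrow>
     (\<forall>C. clique_in (skeleton_vertices V \<Delta>) (skeleton_edges \<Delta>) C \<longrightarrow> C \<in> \<Delta>)"


section \<open>Modules, duals and traces\<close>

text \<open>
  An algebra over \<open>K\<close> is a record \<open>A\<close> of type \<open>module\<close> with \<^term>\<open>algebra K A\<close>: the
  ring operations of \<open>A\<close> are its multiplication and addition, and \<open>module.smult A\<close> is the
  action of the scalars. A module over a ring is a record of the same type whose fields
  \<open>mult\<close> and \<open>one\<close> are ignored.
\<close>

definition module_hom ::
    "('r, 'c) ring_scheme \<Rightarrow> ('r, 'a, 'd) module_scheme \<Rightarrow> ('r, 'b, 'e) module_scheme
      \<Rightarrow> ('a \<Rightarrow> 'b) set" where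
  "module_hom R M N =
     {\<phi> \<in> carrier M \<rightarrow>\<^sub>E carrier N.
        (\<forall>x\<in>carrier M. \<forall>y\<in>carrier M. \<phi> (x \<oplus>\<^bsub>M\<^esub> y) = \<phi> x \<oplus>\<^bsub>N\<^esub> \<phi> y) \<and>
        (\<forall>r\<in>carrier R. \<forall>x\<in>carrier M. \<phi> (r \<odot>\<^bsub>M\<^esub> x) = r \<odot>\<^bsub>N\<^esub> \<phi> x)}"

definition regular_module :: "('a, 'c) ring_scheme \<Rightarrow> ('a, 'a) module" where
  "regular_module R =
     \<lparr>carrier = carrier R, monoid.mult = monoid.mult R, one = one R,
      ring.zero = ring.zero R, add = add R, module.smult = monoid.mult R\<rparr>"

text \<open>
  The canonical module \<open>Hom\<^sub>K(A, K)\<close> of an Artinian algebra \<open>A\<close> over the field \<open>K\<close>,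
  with \<open>A\<close> acting by \<open>(a \<lambda>)(b) = \<lambda>(a b)\<close>.
\<close>

definition canonical_module ::
    "('k, 'c) ring_scheme \<Rightarrow> ('k, 'a, 'd) module_scheme \<Rightarrow> ('a, 'a \<Rightarrow> 'k) module" where
  "canonical_module K A =
     \<lparr>carrier = module_hom K A (regular_module K),
      monoid.mult = undefined,
      one = undefined,
      ring.zero = (\<lambda>b\<in>carrier A. \<zero>\<^bsub>K\<^esub>),
      add = (\<lambda>l l'. \<lambda>b\<in>carrier A. l b \<oplus>\<^bsub>K\<^esub> l' b),
      module.smult = (\<lambda>a l. \<lambda>b\<in>carrier A. l (a \<otimes>\<^bsub>A\<^esub> b))\<rparr>"

text \<open>
  The sum of the images \<open>\<phi>(M)\<close> over all \<open>\<phi> \<in> Hom\<^sub>R(M, R)\<close>; its elements are the sums of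
  finitely many \<open>\<phi>(w\<^sub>\<phi>)\<close> with \<open>w\<^sub>\<phi> \<in> M\<close>.
\<close>

definition module_trace ::
    "('r, 'c) ring_scheme \<Rightarrow> ('r, 'a, 'd) module_scheme \<Rightarrow> 'r set" where
  "module_trace R M =
     {\<Oplus>\<^bsub>R\<^esub>\<phi>\<in>S. \<phi> (w \<phi>) | S w.
        finite S \<and> S \<subseteq> module_hom R M (regular_module R) \<and> w \<in> S \<rightarrow> carrier M}"

definition canonical_trace ::
    "('k, 'c) ring_scheme \<Rightarrow> ('k, 'a, 'd) module_scheme \<Rightarrow> 'a set" where
  "canonical_trace K A = module_trace A (canonical_module K A)"

text \<open>The quotient ring \<open>A Quot I\<close> with the scalar action induced from \<open>A\<close>.\<close>

definition quotient_algebra ::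
    "('k, 'a, 'd) module_scheme \<Rightarrow> 'a set \<Rightarrow> ('k, 'a set) module" where
  "quotient_algebra A I =
     \<lparr>carrier = carrier (A Quot I), monoid.mult = monoid.mult (A Quot I),
      one = one (A Quot I), ring.zero = ring.zero (A Quot I), add = add (A Quot I),
      module.smult = (\<lambda>c Y. \<Union>x\<in>Y. I +>\<^bsub>A\<^esub> (c \<odot>\<^bsub>A\<^esub> x))\<rparr>"


section \<open>Polynomials and Artinian reductions of Stanley--Reisner rings\<close>

text \<open>
  A monomial is its exponent vector \<open>nat \<Rightarrow>\<^sub>0 nat\<close>, and a polynomial maps monomials to
  coefficients; the product on this type is the convolution product.
\<close>

type_synonym 'k mpoly = "(nat \<Rightarrow>\<^sub>0 nat) \<Rightarrow>\<^sub>0 'k"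

definition mvar :: "nat \<Rightarrow> 'k::field mpoly" where
  "mvar i = Poly_Mapping.single (Poly_Mapping.single i 1) 1"

definition squarefree_monom :: "nat set \<Rightarrow> 'k::field mpoly" where
  "squarefree_monom F = (\<Prod>i\<in>F. mvar i)"

text \<open>The polynomials over \<open>'k\<close> in the variables with index in \<open>V\<close>.\<close>

definition mpoly_algebra :: "nat set \<Rightarrow> ('k::field, 'k mpoly) module" where
  "mpoly_algebra V =
     \<lparr>carrier = {p. \<forall>e\<in>Poly_Mapping.keys p. Poly_Mapping.keys e \<subseteq> V},
      monoid.mult = (*), one = 1, ring.zero = 0, add = (+),
      module.smult = (\<lambda>c p. Poly_Mapping.single 0 c * p)\<rparr>"

definition stanley_reisner_ideal :: "nat set \<Rightarrow> nat set set \<Rightarrow> 'k::field mpoly set" where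
  "stanley_reisner_ideal V \<Delta> =
     Idl\<^bsub>mpoly_algebra V\<^esub> {squarefree_monom F | F. F \<subseteq> V \<and> F \<notin> \<Delta>}"

definition pure_power_ideal :: "nat set \<Rightarrow> (nat \<Rightarrow> nat) \<Rightarrow> 'k::field mpoly set" where
  "pure_power_ideal V n = Idl\<^bsub>mpoly_algebra V\<^esub> {mvar i ^ n i | i. i \<in> V}"

definition artinian_ideal ::
    "nat set \<Rightarrow> nat set set \<Rightarrow> (nat \<Rightarrow> nat) \<Rightarrow> 'k::field mpoly set" where
  "artinian_ideal V \<Delta> n =
     stanley_reisner_ideal V \<Delta> <+>\<^bsub>mpoly_algebra V\<^esub> pure_power_ideal V n"

definition artinian_reduction ::
    "nat set \<Rightarrow> nat set set \<Rightarrow> (nat \<Rightarrow> nat) \<Rightarrow> ('k::field, 'k mpoly set) module" where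
  "artinian_reduction V \<Delta> n = quotient_algebra (mpoly_algebra V) (artinian_ideal V \<Delta> n)"

definition residue_monom ::
    "nat set \<Rightarrow> nat set set \<Rightarrow> (nat \<Rightarrow> nat) \<Rightarrow> nat set \<Rightarrow> 'k::field mpoly set" where
  "residue_monom V \<Delta> n F = artinian_ideal V \<Delta> n +>\<^bsub>mpoly_algebra V\<^esub> squarefree_monom F"

end

theory Submission
  imports Defs
begin

text \<open>
  The standard monomials \<open>x\<^sup>b\<close>, whose support is a face and whose exponents are below the \<open>n\<^sub>i\<close>,
  form a basis of \<open>A\<close>; on the dual basis \<open>x\<^sup>a\<close> acts by \<open>b\<close> \<open>\<mapsto>\<close> \<open>b - a\<close> (or zero). So the canonical
  module is generated by the dual basis vectors \<open>\<delta>\<^sub>G\<close> of the socle monomials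
  \<open>s\<^sub>G = \<Prod>\<^bsub>i\<in>G\<^esub> x\<^sub>i\<^bsup>n\<^sub>i - 1\<^esup>\<close>.

  Let \<open>\<phi>\<close> be a homomorphism into \<open>A\<close>. For \<open>i \<notin> G\<close> the variable \<open>x\<^sub>i\<close> kills \<open>\<delta>\<^sub>G\<close>, hence every
  monomial of \<open>\<phi>(\<delta>\<^sub>G)\<close>; as \<open>n\<^sub>i \<ge> 2\<close>, the support \<open>C\<close> of such a monomial satisfies
  \<open>C \<union> {i} \<notin> \<Delta>\<close> for all \<open>i \<notin> G \<union> C\<close>. Thus every face above \<open>C\<close> lies in
  \<open>C \<union> {g \<in> G. C \<union> {g} \<in> \<Delta>}\<close>, which is a clique and therefore a face: \<open>C\<close> is free.

  Conversely, if \<open>G\<close> is the only facet above \<open>F\<close>, then sending the dual basis vector of \<open>x\<^sup>b\<close> to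
  \<open>x\<^sub>F s\<^sub>G / x\<^sup>b\<close> if \<open>x\<^sup>b\<close> divides \<open>s\<^sub>G\<close>, and to zero otherwise, is a homomorphism that maps
  \<open>\<delta>\<^sub>G\<close> to \<open>x\<^sub>F\<close>.
\<close>

section \<open>Traces, duals and quotient algebras\<close>

lemma regular_module_simps [simp]:
  "carrier (regular_module R) = carrier R"
  "add (regular_module R) = add R"
  "ring.zero (regular_module R) = ring.zero R"
  "module.smult (regular_module R) = monoid.mult R"
  by (simp_all add: regular_module_def)

lemma module_homD:
  assumes "\<phi> \<in> module_hom R M N"
  shows "\<phi> \<in> carrier M \<rightarrow>\<^sub>E carrier N"
    and "x \<in> carrier M \<Longrightarrow> \<phi> x \<in> carrier N"
    and "x \<in> carrier M \<Longrightarrow> y \<in> carrier M \<Longrightarrow> \<phi> (x \<oplus>\<^bsub>M\<^esub> y) = \<phi> x \<oplus>\<^bsub>N\<^esub> \<phi> y"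
    and "r \<in> carrier R \<Longrightarrow> x \<in> carrier M \<Longrightarrow> \<phi> (r \<odot>\<^bsub>M\<^esub> x) = r \<odot>\<^bsub>N\<^esub> \<phi> x"
  using assms by (auto simp: module_hom_def)

lemma module_homI:
  assumes "\<phi> \<in> carrier M \<rightarrow>\<^sub>E carrier N"
    and "\<And>x y. x \<in> carrier M \<Longrightarrow> y \<in> carrier M \<Longrightarrow> \<phi> (x \<oplus>\<^bsub>M\<^esub> y) = \<phi> x \<oplus>\<^bsub>N\<^esub> \<phi> y"
    and "\<And>r x. r \<in> carrier R \<Longrightarrow> x \<in> carrier M \<Longrightarrow> \<phi> (r \<odot>\<^bsub>M\<^esub> x) = r \<odot>\<^bsub>N\<^esub> \<phi> x"
  shows "\<phi> \<in> module_hom R M N"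
  using assms by (auto simp: module_hom_def)

text \<open>Negation needs no condition of its own, since \<open>\<ominus> a\<close> is the multiple
  of \<open>a\<close> by \<open>\<ominus> \<one>\<close>. The rule serves ideals given by a
  membership condition: the trace, and the polynomials without standard monomials.\<close>

lemma (in cring) ideal_of_closed:
  assumes "J \<subseteq> carrier R" "\<zero> \<in> J"
    and "\<And>x y. x \<in> J \<Longrightarrow> y \<in> J \<Longrightarrow> x \<oplus> y \<in> J"
    and l: "\<And>a x. a \<in> carrier R \<Longrightarrow> x \<in> J \<Longrightarrow> a \<otimes> x \<in> J"
  shows "ideal J R"
proof (rule idealI[OF ring_axioms])
  show "subgroup J (add_monoid R)"
  proof (rule add.subgroupI)
    fix a assume "a \<in> J"
    then have "\<ominus> a = (\<ominus> \<one>) \<otimes> a"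
      using assms(1) by (simp add: l_minus subset_iff)
    then show "\<ominus> a \<in> J"
      using l[of "\<ominus> \<one>" a] \<open>a \<in> J\<close> by simp
  qed (use assms in auto)
  show "a \<otimes> x \<in> J" if "a \<in> J" "x \<in> carrier R" for a x
    using l[of x a] that assms(1) m_comm[of a x] by auto
qed (use l in auto)

lemma module_hom_zero:
  assumes "module R M" and phi: "\<phi> \<in> module_hom R M (regular_module R)"
  shows "\<phi> \<zero>\<^bsub>M\<^esub> = \<zero>\<^bsub>R\<^esub>"
proof -
  interpret module R M by fact
  have "\<phi> \<zero>\<^bsub>M\<^esub> \<in> carrier R"
    using module_homD(2)[OF phi M.zero_closed] by simp
  then show ?thesis
    using module_homD(4)[OF phi R.zero_closed M.zero_closed] by simp
qed

lemma module_trace_memI: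
  assumes R: "cring R" and "\<phi> \<in> module_hom R M (regular_module R)" "w \<in> carrier M"
  shows "\<phi> w \<in> module_trace R M"
proof -
  interpret cring R by fact
  have "\<phi> w \<in> carrier R"
    using module_homD(2)[OF assms(2,3)] by simp
  then have "(\<Oplus>\<^bsub>R\<^esub>\<psi>\<in>{\<phi>}. \<psi> ((\<lambda>_. w) \<psi>)) = \<phi> w"
    by simp
  then show ?thesis
    unfolding module_trace_def using assms(2,3)
    by (intro CollectI exI[of _ "{\<phi>}"] exI[of _ "\<lambda>_. w"]) auto
qed

text \<open>An element of the trace carries one vector per homomorphism. To add two of them, both
  families of vectors are extended by zero to the union of the index sets; additivity then merges
  the two vectors that belong to the same homomorphism.\<close>

lemma module_trace_ideal:
  assumes "module R M"
  shows "ideal (module_trace R M) R"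
proof -
  interpret module R M by fact
  let ?H = "module_hom R M (regular_module R)"
  have H: "\<phi> w \<in> carrier R" if "\<phi> \<in> ?H" "w \<in> carrier M" for \<phi> w
    using module_homD(2)[OF that] by simp
  have H0: "\<phi> \<zero>\<^bsub>M\<^esub> = \<zero>\<^bsub>R\<^esub>" if "\<phi> \<in> ?H" for \<phi>
    using assms that by (rule module_hom_zero)
  show ?thesis
  proof (rule R.ideal_of_closed)
    show "module_trace R M \<subseteq> carrier R"
      unfolding module_trace_def using H by (auto intro!: R.finsum_closed)
    show "\<zero>\<^bsub>R\<^esub> \<in> module_trace R M"
      unfolding module_trace_def by (auto intro!: exI[of _ "{}"])
  next
    fix x y assume "x \<in> module_trace R M" "y \<in> module_trace R M"
    then obtain S u T w where
      S: "finite S" "S \<subseteq> ?H" "u \<in> S \<rightarrow> carrier M" "x = (\<Oplus>\<^bsub>R\<^esub>\<phi>\<in>S. \<phi> (u \<phi>))" and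
      T: "finite T" "T \<subseteq> ?H" "w \<in> T \<rightarrow> carrier M" "y = (\<Oplus>\<^bsub>R\<^esub>\<phi>\<in>T. \<phi> (w \<phi>))"
      unfolding module_trace_def by blast
    define u' w' where "u' \<phi> = (if \<phi> \<in> S then u \<phi> else \<zero>\<^bsub>M\<^esub>)"
      and "w' \<phi> = (if \<phi> \<in> T then w \<phi> else \<zero>\<^bsub>M\<^esub>)" for \<phi>
    have cl: "u' \<phi> \<in> carrier M" "w' \<phi> \<in> carrier M" for \<phi>
      using S(3) T(3) by (auto simp: u'_def w'_def)
    have "x = (\<Oplus>\<^bsub>R\<^esub>\<phi>\<in>S \<union> T. \<phi> (u' \<phi>))"
      unfolding S(4) by (rule R.add.finprod_mono_neutral_cong_left)
        (use S T H H0 cl in \<open>auto simp: u'_def subset_iff Pi_iff\<close>)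
    moreover have "y = (\<Oplus>\<^bsub>R\<^esub>\<phi>\<in>S \<union> T. \<phi> (w' \<phi>))"
      unfolding T(4) by (rule R.add.finprod_mono_neutral_cong_left)
        (use S T H H0 cl in \<open>auto simp: w'_def subset_iff Pi_iff\<close>)
    ultimately have "x \<oplus>\<^bsub>R\<^esub> y = (\<Oplus>\<^bsub>R\<^esub>\<phi>\<in>S \<union> T. \<phi> (u' \<phi>) \<oplus>\<^bsub>R\<^esub> \<phi> (w' \<phi>))"
      using S T H cl by (subst R.finsum_addf) (auto simp: subset_iff)
    also have "\<dots> = (\<Oplus>\<^bsub>R\<^esub>\<phi>\<in>S \<union> T. \<phi> (u' \<phi> \<oplus>\<^bsub>M\<^esub> w' \<phi>))"
      using S T H cl by (intro R.finsum_cong') (auto simp: module_homD(3) subset_iff)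
    finally show "x \<oplus>\<^bsub>R\<^esub> y \<in> module_trace R M"
      unfolding module_trace_def using S T cl
      by (intro CollectI exI[of _ "S \<union> T"] exI[of _ "\<lambda>\<phi>. u' \<phi> \<oplus>\<^bsub>M\<^esub> w' \<phi>"]) auto
  next
    fix a x assume a: "a \<in> carrier R" and "x \<in> module_trace R M"
    then obtain S u where
      S: "finite S" "S \<subseteq> ?H" "u \<in> S \<rightarrow> carrier M" "x = (\<Oplus>\<^bsub>R\<^esub>\<phi>\<in>S. \<phi> (u \<phi>))"
      unfolding module_trace_def by blast
    have "a \<otimes>\<^bsub>R\<^esub> x = (\<Oplus>\<^bsub>R\<^esub>\<phi>\<in>S. a \<otimes>\<^bsub>R\<^esub> \<phi> (u \<phi>))"
      unfolding S(4) using S(1-3) H a by (intro R.finsum_rdistr) (auto simp: subset_iff Pi_iff)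
    also have "\<dots> = (\<Oplus>\<^bsub>R\<^esub>\<phi>\<in>S. \<phi> (a \<odot>\<^bsub>M\<^esub> u \<phi>))"
      using S(1-3) H a by (intro R.finsum_cong') (auto simp: module_homD(4) subset_iff Pi_iff)
    finally show "a \<otimes>\<^bsub>R\<^esub> x \<in> module_trace R M"
      unfolding module_trace_def using S a
      by (intro CollectI exI[of _ S] exI[of _ "\<lambda>\<phi>. a \<odot>\<^bsub>M\<^esub> u \<phi>"]) auto
  qed
qed

section \<open>The canonical module\<close>

lemma canonical_module_simps [simp]:
  "carrier (canonical_module K A) = module_hom K A (regular_module K)"
  "\<zero>\<^bsub>canonical_module K A\<^esub> = (\<lambda>b\<in>carrier A. \<zero>\<^bsub>K\<^esub>)"
  "l \<oplus>\<^bsub>canonical_module K A\<^esub> l' = (\<lambda>b\<in>carrier A. l b \<oplus>\<^bsub>K\<^esub> l' b)"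
  "a \<odot>\<^bsub>canonical_module K A\<^esub> l = (\<lambda>b\<in>carrier A. l (a \<otimes>\<^bsub>A\<^esub> b))"
  by (simp_all add: canonical_module_def)

text \<open>Commutativity moves the scalar past the left factor. This is what makes the functional
  \<open>a \<lambda>\<close> linear over the ground ring again.\<close>

lemma (in algebra) smult_assoc2':
  assumes "a \<in> carrier R" "x \<in> carrier M" "y \<in> carrier M"
  shows "x \<otimes>\<^bsub>M\<^esub> (a \<odot>\<^bsub>M\<^esub> y) = a \<odot>\<^bsub>M\<^esub> (x \<otimes>\<^bsub>M\<^esub> y)"
  using assms smult_assoc2[of a y x] by (simp add: m_comm[of x])

lemma module_canonical_module:
  assumes "algebra K A"
  shows "module A (canonical_module K A)"
proof -
  interpret algebra K A by fact
  let ?W = "module_hom K A (regular_module K)"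
  let ?M = "canonical_module K A"
  have cl: "f x \<in> carrier K" if "f \<in> ?W" "x \<in> carrier A" for f x
    using module_homD(2)[OF that] by simp
  have ad: "f (x \<oplus>\<^bsub>A\<^esub> y) = f x \<oplus>\<^bsub>K\<^esub> f y" if "f \<in> ?W" "x \<in> carrier A" "y \<in> carrier A" for f x y
    using module_homD(3)[OF that] by simp
  have sm: "f (c \<odot>\<^bsub>A\<^esub> x) = c \<otimes>\<^bsub>K\<^esub> f x" if "f \<in> ?W" "c \<in> carrier K" "x \<in> carrier A" for f x c
    using module_homD(4)[OF that] by simp
  \<comment> \<open>Homomorphisms are extensional. The law \<open>0 + f = f\<close> is an equation
    of functions, so it also needs the value of \<open>f\<close> off the carrier.\<close>
  have ex: "f x = undefined" if "f \<in> ?W" "x \<notin> carrier A" for f x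
    using module_homD(1)[OF that(1)] that(2) by (auto simp: PiE_def extensional_def)
  have W_add: "(\<lambda>b\<in>carrier A. f b \<oplus>\<^bsub>K\<^esub> g b) \<in> ?W" if "f \<in> ?W" "g \<in> ?W" for f g
    by (rule module_homI) (use that in \<open>auto simp: cl ad sm R.a_ac R.r_distr\<close>)
  have W_zero: "(\<lambda>b\<in>carrier A. \<zero>\<^bsub>K\<^esub>) \<in> ?W"
    by (rule module_homI) auto
  have W_smult: "(\<lambda>b\<in>carrier A. f (a \<otimes>\<^bsub>A\<^esub> b)) \<in> ?W" if "f \<in> ?W" "a \<in> carrier A" for f a
    by (rule module_homI) (use that in \<open>auto simp: cl ad sm r_distr smult_assoc2'\<close>)
  have W_neg: "(\<lambda>b\<in>carrier A. \<ominus>\<^bsub>K\<^esub> f b) \<in> ?W" if "f \<in> ?W" for f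
    by (rule module_homI) (use that in \<open>auto simp: cl ad sm R.minus_add R.r_minus\<close>)
  show ?thesis
  proof (rule moduleI)
    show "cring A" by (rule M_cring)
    show "abelian_group ?M"
    proof (rule abelian_groupI; simp only: canonical_module_simps)
      fix f g h assume fgh: "f \<in> ?W" "g \<in> ?W" "h \<in> ?W"
      show "(\<lambda>b\<in>carrier A. (\<lambda>b\<in>carrier A. f b \<oplus>\<^bsub>K\<^esub> g b) b \<oplus>\<^bsub>K\<^esub> h b) =
            (\<lambda>b\<in>carrier A. f b \<oplus>\<^bsub>K\<^esub> (\<lambda>b\<in>carrier A. g b \<oplus>\<^bsub>K\<^esub> h b) b)"
        using fgh by (auto intro!: restrict_ext simp: cl R.a_ac)
    next
      fix f g assume fg: "f \<in> ?W" "g \<in> ?W"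
      show "(\<lambda>b\<in>carrier A. f b \<oplus>\<^bsub>K\<^esub> g b) = (\<lambda>b\<in>carrier A. g b \<oplus>\<^bsub>K\<^esub> f b)"
        using fg by (auto intro!: restrict_ext simp: cl R.a_ac)
    next
      fix f assume f: "f \<in> ?W"
      show "(\<lambda>b\<in>carrier A. (\<lambda>b\<in>carrier A. \<zero>\<^bsub>K\<^esub>) b \<oplus>\<^bsub>K\<^esub> f b) = f"
        using f by (auto simp: cl ex)
      show "\<exists>g\<in>?W. (\<lambda>b\<in>carrier A. g b \<oplus>\<^bsub>K\<^esub> f b) = (\<lambda>b\<in>carrier A. \<zero>\<^bsub>K\<^esub>)"
        using f by (intro bexI[OF _ W_neg[OF f]]) (auto intro!: restrict_ext simp: cl R.l_neg)
    qed (use W_add W_zero in auto)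
  qed (use W_add W_smult in \<open>auto intro!: restrict_ext simp: cl ad ex l_distr r_distr m_ac\<close>)
qed

section \<open>Quotient algebras\<close>

lemma quotient_algebra_simps [simp]:
  "carrier (quotient_algebra A I) = carrier (A Quot I)"
  "monoid.mult (quotient_algebra A I) = monoid.mult (A Quot I)"
  "one (quotient_algebra A I) = one (A Quot I)"
  "ring.zero (quotient_algebra A I) = ring.zero (A Quot I)"
  "add (quotient_algebra A I) = add (A Quot I)"
  by (simp_all add: quotient_algebra_def)

text \<open>Carries the ring laws of \<open>A Quot I\<close> over to
  \<open>quotient_algebra A I\<close>, a record of another type with the same ring
  operations.\<close>

lemma cring_cong:
  assumes "cring R" "carrier S = carrier R" "monoid.mult S = monoid.mult R"
    "one S = one R" "ring.zero S = ring.zero R" "add S = add R"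
  shows "cring S"
proof -
  interpret cring R by fact
  show ?thesis
  proof (rule cringI)
    show "abelian_group S"
      by (rule abelian_groupI) (use assms in \<open>auto simp: a_ac intro: l_neg bexI[of _ "\<ominus>\<^bsub>R\<^esub> _"]\<close>)
    show "Group.comm_monoid S"
      by (rule comm_monoidI) (use assms in \<open>auto simp: m_ac\<close>)
  qed (use assms in \<open>auto simp: l_distr\<close>)
qed

text \<open>The union in the definition runs over all representatives of the coset. It collapses to
  one coset because \<open>c h = (c 1) h\<close> stays in \<open>I\<close> for \<open>h\<close> in
  \<open>I\<close>.\<close>

lemma quotient_algebra_smult:
  assumes "algebra K A" "ideal I A" "c \<in> carrier K" "x \<in> carrier A"
  shows "c \<odot>\<^bsub>quotient_algebra A I\<^esub> (I +>\<^bsub>A\<^esub> x) = I +>\<^bsub>A\<^esub> (c \<odot>\<^bsub>A\<^esub> x)"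
proof -
  interpret algebra K A by fact
  interpret ideal I A by fact
  have "I +>\<^bsub>A\<^esub> (c \<odot>\<^bsub>A\<^esub> y) = I +>\<^bsub>A\<^esub> (c \<odot>\<^bsub>A\<^esub> x)" if "y \<in> I +>\<^bsub>A\<^esub> x" for y
  proof -
    obtain h where h: "h \<in> I" "y = h \<oplus>\<^bsub>A\<^esub> x"
      using \<open>y \<in> _\<close> by (auto simp: a_r_coset_def r_coset_def)
    have hA: "h \<in> carrier A"
      using h(1) by (rule a_Hcarr)
    have "c \<odot>\<^bsub>A\<^esub> h = (c \<odot>\<^bsub>A\<^esub> \<one>\<^bsub>A\<^esub>) \<otimes>\<^bsub>A\<^esub> h"
      using smult_assoc2[of c "\<one>\<^bsub>A\<^esub>" h] assms hA by simp
    then have "c \<odot>\<^bsub>A\<^esub> h \<in> I"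
      using I_l_closed[OF h(1), of "c \<odot>\<^bsub>A\<^esub> \<one>\<^bsub>A\<^esub>"] assms by simp
    moreover have "c \<odot>\<^bsub>A\<^esub> y = c \<odot>\<^bsub>A\<^esub> h \<oplus>\<^bsub>A\<^esub> c \<odot>\<^bsub>A\<^esub> x"
      using assms hA by (simp add: h smult_r_distr)
    ultimately have "c \<odot>\<^bsub>A\<^esub> y \<in> I +>\<^bsub>A\<^esub> (c \<odot>\<^bsub>A\<^esub> x)"
      by (auto simp: a_r_coset_def r_coset_def)
    then show ?thesis
      using a_repr_independence'[of "c \<odot>\<^bsub>A\<^esub> y" "c \<odot>\<^bsub>A\<^esub> x"] assms by simp
  qed
  moreover have "x \<in> I +>\<^bsub>A\<^esub> x"
    using assms(4) by (rule a_rcos_self)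
  ultimately have "(\<Union>y\<in>I +>\<^bsub>A\<^esub> x. I +>\<^bsub>A\<^esub> (c \<odot>\<^bsub>A\<^esub> y)) = I +>\<^bsub>A\<^esub> (c \<odot>\<^bsub>A\<^esub> x)"
    by blast
  then show ?thesis
    by (simp add: quotient_algebra_def)
qed

lemma algebra_quotient_algebra:
  assumes "algebra K A" "ideal I A"
  shows "algebra K (quotient_algebra A I)"
proof -
  interpret algebra K A by fact
  interpret ideal I A by fact
  have carr: "\<exists>y\<in>carrier A. Y = I +>\<^bsub>A\<^esub> y" if "Y \<in> carrier (A Quot I)" for Y
    using that by (auto simp: FactRing_simps)
  have mem: "I +>\<^bsub>A\<^esub> y \<in> carrier (A Quot I)" if "y \<in> carrier A" for y
    using that by (auto simp: FactRing_simps)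
  have ops: "(I +>\<^bsub>A\<^esub> x) \<oplus>\<^bsub>A Quot I\<^esub> (I +>\<^bsub>A\<^esub> y) = I +>\<^bsub>A\<^esub> (x \<oplus>\<^bsub>A\<^esub> y)"
    "(I +>\<^bsub>A\<^esub> x) \<otimes>\<^bsub>A Quot I\<^esub> (I +>\<^bsub>A\<^esub> y) = I +>\<^bsub>A\<^esub> (x \<otimes>\<^bsub>A\<^esub> y)"
    if "x \<in> carrier A" "y \<in> carrier A" for x y
    using that by (auto simp: FactRing_simps rcoset_mult_add a_rcos_sum)
  note sm = quotient_algebra_smult[OF assms]
  show ?thesis
  proof (rule algebraI)
    show "cring (quotient_algebra A I)"
      by (rule cring_cong[OF quotient_is_cring[OF M_cring]]) simp_all
  next
    fix c Y assume c: "c \<in> carrier K" and Y: "Y \<in> carrier (quotient_algebra A I)"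
    obtain x where "x \<in> carrier A" "Y = I +>\<^bsub>A\<^esub> x"
      using carr[of Y] Y by auto
    then show "c \<odot>\<^bsub>quotient_algebra A I\<^esub> Y \<in> carrier (quotient_algebra A I)"
      using c by (simp_all add: sm mem)
    fix d assume "d \<in> carrier K"
    with \<open>x \<in> _\<close> \<open>Y = _\<close> c show
      "(c \<oplus>\<^bsub>K\<^esub> d) \<odot>\<^bsub>quotient_algebra A I\<^esub> Y = c \<odot>\<^bsub>quotient_algebra A I\<^esub> Y
        \<oplus>\<^bsub>quotient_algebra A I\<^esub> d \<odot>\<^bsub>quotient_algebra A I\<^esub> Y"
      "(c \<otimes>\<^bsub>K\<^esub> d) \<odot>\<^bsub>quotient_algebra A I\<^esub> Y =
        c \<odot>\<^bsub>quotient_algebra A I\<^esub> (d \<odot>\<^bsub>quotient_algebra A I\<^esub> Y)"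
      by (simp_all add: sm ops smult_l_distr smult_assoc1)
  next
    fix Y assume Y: "Y \<in> carrier (quotient_algebra A I)"
    obtain x where "x \<in> carrier A" "Y = I +>\<^bsub>A\<^esub> x"
      using carr[of Y] Y by auto
    then show "\<one>\<^bsub>K\<^esub> \<odot>\<^bsub>quotient_algebra A I\<^esub> Y = Y"
      by (simp add: sm)
  next
    fix c Y Z assume c: "c \<in> carrier K"
      and XY: "Y \<in> carrier (quotient_algebra A I)" "Z \<in> carrier (quotient_algebra A I)"
    obtain x y where "x \<in> carrier A" "Y = I +>\<^bsub>A\<^esub> x" "y \<in> carrier A" "Z = I +>\<^bsub>A\<^esub> y"
      using carr[of Y] carr[of Z] XY by auto
    then show "c \<odot>\<^bsub>quotient_algebra A I\<^esub> (Y \<oplus>\<^bsub>quotient_algebra A I\<^esub> Z) =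
        c \<odot>\<^bsub>quotient_algebra A I\<^esub> Y \<oplus>\<^bsub>quotient_algebra A I\<^esub> c \<odot>\<^bsub>quotient_algebra A I\<^esub> Z"
      "c \<odot>\<^bsub>quotient_algebra A I\<^esub> Y \<otimes>\<^bsub>quotient_algebra A I\<^esub> Z =
        c \<odot>\<^bsub>quotient_algebra A I\<^esub> (Y \<otimes>\<^bsub>quotient_algebra A I\<^esub> Z)"
      using c by (simp_all add: sm ops smult_r_distr smult_assoc2)
  qed (rule R.is_cring)
qed

section \<open>Monomials\<close>

lemma ring_of_type_algebra_simps [simp]:
  "carrier ring_of_type_algebra = UNIV"
  "x \<otimes>\<^bsub>ring_of_type_algebra\<^esub> y = x * y"
  "x \<oplus>\<^bsub>ring_of_type_algebra\<^esub> y = x + y"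
  "\<one>\<^bsub>ring_of_type_algebra\<^esub> = 1"
  "\<zero>\<^bsub>ring_of_type_algebra\<^esub> = 0"
  by (simp_all add: ring_of_type_algebra_def)

lemma mem_mpoly_algebra_iff:
  "p \<in> carrier (mpoly_algebra V) \<longleftrightarrow> (\<forall>e\<in>Poly_Mapping.keys p. Poly_Mapping.keys e \<subseteq> V)"
  by (simp add: mpoly_algebra_def)

lemma mpoly_algebra_simps [simp]:
  "p \<otimes>\<^bsub>mpoly_algebra V\<^esub> q = p * q"
  "p \<oplus>\<^bsub>mpoly_algebra V\<^esub> q = p + q"
  "\<one>\<^bsub>mpoly_algebra V\<^esub> = 1"
  "\<zero>\<^bsub>mpoly_algebra V\<^esub> = 0"
  "c \<odot>\<^bsub>mpoly_algebra V\<^esub> p = Poly_Mapping.single 0 c * p"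
  by (simp_all add: mpoly_algebra_def)

lemma keys_add_nat:
  "Poly_Mapping.keys (a + b) = Poly_Mapping.keys a \<union> Poly_Mapping.keys (b :: 'v \<Rightarrow>\<^sub>0 nat)"
  by (auto simp: lookup_add simp flip: lookup_not_eq_zero_eq_in_keys)

lemma keys_subsetI: "(\<And>i. Poly_Mapping.lookup e i \<noteq> 0 \<Longrightarrow> i \<in> S) \<Longrightarrow> Poly_Mapping.keys e \<subseteq> S"
  by (meson in_keys_iff subsetI)

lemma mpoly_closed:
  assumes "p \<in> carrier (mpoly_algebra V)" "q \<in> carrier (mpoly_algebra V)"
  shows "p + q \<in> carrier (mpoly_algebra V)" "p * q \<in> carrier (mpoly_algebra V)"
proof -
  show "p + q \<in> carrier (mpoly_algebra V)"
    using assms keys_add[of p q] by (auto simp: mem_mpoly_algebra_iff)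
  show "p * q \<in> carrier (mpoly_algebra V)"
    using assms keys_mult[of p q] by (fastforce simp: mem_mpoly_algebra_iff keys_add_nat)
qed

lemma mpoly_uminus_closed:
  "p \<in> carrier (mpoly_algebra V) \<Longrightarrow> - p \<in> carrier (mpoly_algebra V)"
  by (auto simp: mem_mpoly_algebra_iff in_keys_iff)

lemma mpoly_sum_closed:
  assumes "\<And>i. i \<in> S \<Longrightarrow> f i \<in> carrier (mpoly_algebra V)"
  shows "sum f S \<in> carrier (mpoly_algebra V)"
  using assms
proof (induction S rule: infinite_finite_induct)
  case (insert i S)
  then show ?case
    by (simp add: mpoly_closed(1))
qed (simp_all add: mem_mpoly_algebra_iff)

lemma single_in_mpoly_algebra:
  "Poly_Mapping.keys e \<subseteq> V \<Longrightarrow> Poly_Mapping.single e c \<in> carrier (mpoly_algebra V)"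
  by (simp add: mem_mpoly_algebra_iff)

lemma algebra_mpoly_algebra:
  "algebra (ring_of_type_algebra :: 'k::field ring) (mpoly_algebra V)"
proof (rule algebraI)
  show "cring (mpoly_algebra V :: ('k, 'k mpoly) module)"
  proof (rule cringI)
    show "abelian_group (mpoly_algebra V :: ('k, 'k mpoly) module)"
    proof (rule abelian_groupI)
      fix p :: "'k mpoly" assume "p \<in> carrier (mpoly_algebra V)"
      then show "\<exists>q\<in>carrier (mpoly_algebra V).
          q \<oplus>\<^bsub>mpoly_algebra V\<^esub> p = \<zero>\<^bsub>mpoly_algebra V\<^esub>"
        by (intro bexI[of _ "- p"] mpoly_uminus_closed) auto
    qed (use mpoly_closed(1) in \<open>auto simp: ac_simps mem_mpoly_algebra_iff[of 0] mem_mpoly_algebra_iff[of 1]\<close>)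
    show "Group.comm_monoid (mpoly_algebra V :: ('k, 'k mpoly) module)"
      by (rule comm_monoidI)
        (use mpoly_closed(2) in \<open>auto simp: ac_simps mem_mpoly_algebra_iff[of 0] mem_mpoly_algebra_iff[of 1]\<close>)
  qed (simp add: distrib_right)
  show "cring (ring_of_type_algebra :: 'k ring)"
    by (rule cring_from_type_algebra)
  show "c \<odot>\<^bsub>mpoly_algebra V\<^esub> p \<in> carrier (mpoly_algebra V)"
    if "p \<in> carrier (mpoly_algebra V)" for c :: 'k and p
    using mpoly_closed(2)[OF single_in_mpoly_algebra[of 0 V c] that] by simp
qed (simp_all add: single_add distrib_right distrib_left mult_single ac_simps)

text \<open>In the convolution sum only \<open>l = a\<close> contributes, and cancellation in the
  exponent monoid then leaves only \<open>q = t\<close>.\<close>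

lemma lookup_single_mult_add:
  fixes a t :: "'a::cancel_comm_monoid_add" and c :: "'b::semiring_0"
  shows "Poly_Mapping.lookup (Poly_Mapping.single a c * p) (a + t) = c * Poly_Mapping.lookup p t"
proof -
  have "Poly_Mapping.lookup (Poly_Mapping.single a c * p) (a + t) =
      (\<Sum>l. (c * (\<Sum>q. Poly_Mapping.lookup p q when a + t = l + q)) when l = a)"
    unfolding lookup_mult by (rule Sum_any.cong) (simp add: lookup_single when_def)
  also have "\<dots> = c * (\<Sum>q. Poly_Mapping.lookup p q when t = q)"
    by simp
  finally show ?thesis
    by simp
qed

lemma lookup_single_mult_eq_0:
  fixes a :: "'a::cancel_comm_monoid_add" and c :: "'b::semiring_0"
  assumes "\<And>t. e \<noteq> a + t"
  shows "Poly_Mapping.lookup (Poly_Mapping.single a c * p) e = 0"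
proof -
  have "Poly_Mapping.lookup (Poly_Mapping.single a c * p) e =
      (\<Sum>l. (c * (\<Sum>q. Poly_Mapping.lookup p q when e = l + q)) when l = a)"
    unfolding lookup_mult by (rule Sum_any.cong) (simp add: lookup_single when_def)
  also have "\<dots> = 0"
    using assms by simp
  finally show ?thesis .
qed

lemma sum_single_lookup: "(\<Sum>e\<in>Poly_Mapping.keys p. Poly_Mapping.single e (Poly_Mapping.lookup p e)) = p"
  by (rule poly_mapping_eqI) (auto simp: lookup_sum lookup_single when_def in_keys_iff)

lemma lookup_sum_single:
  "finite S \<Longrightarrow> Poly_Mapping.lookup (\<Sum>e\<in>S. Poly_Mapping.single e (f e)) t = (if t \<in> S then f t else 0)"
  by (auto simp: lookup_sum lookup_single when_def)

section \<open>Standard exponents and the monomial description of the Artinian ideal\<close>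

definition squarefree_exponent :: "nat set \<Rightarrow> nat \<Rightarrow>\<^sub>0 nat" where
  "squarefree_exponent F = (\<Sum>i\<in>F. Poly_Mapping.single i 1)"

lemma lookup_squarefree_exponent:
  "finite F \<Longrightarrow> Poly_Mapping.lookup (squarefree_exponent F) i = (if i \<in> F then 1 else 0)"
  unfolding squarefree_exponent_def by (rule lookup_sum_single)

lemma keys_squarefree_exponent: "finite F \<Longrightarrow> Poly_Mapping.keys (squarefree_exponent F) = F"
  by (rule Set.set_eqI) (simp add: lookup_squarefree_exponent flip: lookup_not_eq_zero_eq_in_keys)

lemma squarefree_monom_eq_single: "squarefree_monom F = Poly_Mapping.single (squarefree_exponent F) 1"
  unfolding squarefree_monom_def squarefree_exponent_def
  by (induction F rule: infinite_finite_induct) (simp_all add: mvar_def mult_single)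

lemma mvar_power_eq_single: "mvar i ^ k = Poly_Mapping.single (Poly_Mapping.single i k) 1"
  by (induction k) (simp_all add: mvar_def mult_single single_add[symmetric])

text \<open>Subtraction of exponents is truncated in each coordinate; divisibility of
  \<open>x^e\<close> by \<open>x^a\<close> makes it exact.\<close>

lemma le_exponent_add_diff:
  assumes "\<And>i. Poly_Mapping.lookup a i \<le> Poly_Mapping.lookup e i"
  shows "a + (e - a) = (e :: 'v \<Rightarrow>\<^sub>0 nat)"
  by (rule poly_mapping_eqI) (simp add: lookup_add lookup_minus assms)

definition standard_exponents :: "nat set \<Rightarrow> nat set set \<Rightarrow> (nat \<Rightarrow> nat) \<Rightarrow> (nat \<Rightarrow>\<^sub>0 nat) set" where
  "standard_exponents V \<Delta> n = {e. Poly_Mapping.keys e \<in> \<Delta> \<and> (\<forall>i\<in>V. Poly_Mapping.lookup e i < n i)}"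

text \<open>Both conditions survive lowering exponents: faces are closed under subsets, and the
  bounds are upper bounds. Read contrapositively, multiples of nonstandard monomials are
  nonstandard.\<close>

lemma standard_exponents_mono:
  assumes "simplicial_complex_on V \<Delta>" "a + b \<in> standard_exponents V \<Delta> n"
  shows "b \<in> standard_exponents V \<Delta> n"
  using assms unfolding standard_exponents_def simplicial_complex_on_def
  by (auto simp: keys_add_nat lookup_add intro: le_less_trans[OF le_add2])

text \<open>The support is a face, so a standard exponent vanishes off \<open>V\<close>; restriction
  to \<open>V\<close> is therefore injective and lands in a finite box.\<close>

lemma finite_standard_exponents:
  assumes "finite V" "simplicial_complex_on V \<Delta>"
  shows "finite (standard_exponents V \<Delta> n)"
proof (rule inj_on_finite)
  let ?f = "\<lambda>e::nat \<Rightarrow>\<^sub>0 nat. restrict (Poly_Mapping.lookup e) V"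
  show "finite (\<Pi>\<^sub>E i\<in>V. {..<n i})"
    using assms(1) by (intro finite_PiE) auto
  show "?f ` standard_exponents V \<Delta> n \<subseteq> (\<Pi>\<^sub>E i\<in>V. {..<n i})"
    by (auto simp: standard_exponents_def)
  show "inj_on ?f (standard_exponents V \<Delta> n)"
  proof (rule inj_onI, rule poly_mapping_eqI)
    fix a b i assume ab: "a \<in> standard_exponents V \<Delta> n" "b \<in> standard_exponents V \<Delta> n"
      and eq: "?f a = ?f b"
    have "i \<in> V" if "Poly_Mapping.lookup a i \<noteq> 0 \<or> Poly_Mapping.lookup b i \<noteq> 0"
      using that[unfolded lookup_not_eq_zero_eq_in_keys] ab assms(2)
      by (auto simp: standard_exponents_def simplicial_complex_on_def)
    moreover have "Poly_Mapping.lookup a i = Poly_Mapping.lookup b i" if "i \<in> V"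
      using fun_cong[OF eq, of i] that by simp
    ultimately show "Poly_Mapping.lookup a i = Poly_Mapping.lookup b i"
      by metis
  qed
qed

lemma ideal_sum_closed:
  assumes J: "ideal J (mpoly_algebra V)" and S: "\<And>e. e \<in> S \<Longrightarrow> f e \<in> J"
  shows "sum f S \<in> J"
  using S
proof (induction S rule: infinite_finite_induct)
  case (insert e S)
  then show ?case
    using additive_subgroup.a_closed[OF ideal.axioms(1)[OF J], of "f e" "sum f S"] by simp
qed (use additive_subgroup.zero_closed[OF ideal.axioms(1)[OF J]] in simp_all)

text \<open>All generators are monomials, so membership is decided monomial by monomial. The
  right-hand side is an ideal containing the generators; conversely, each nonstandard monomial in
  the variables from \<open>V\<close> is a multiple of a generator.\<close>

lemma artinian_ideal_eq:
  assumes fin: "finite V" and cplx: "simplicial_complex_on V \<Delta>"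
  shows "(artinian_ideal V \<Delta> n :: 'k::field mpoly set) =
    {p \<in> carrier (mpoly_algebra V). Poly_Mapping.keys p \<inter> standard_exponents V \<Delta> n = {}}" (is "?I = ?J")
    and "ideal (artinian_ideal V \<Delta> n :: 'k mpoly set) (mpoly_algebra V)"
proof -
  let ?P = "mpoly_algebra V :: ('k, 'k mpoly) module"
  let ?B = "standard_exponents V \<Delta> n"
  interpret P: algebra "ring_of_type_algebra :: 'k ring" ?P
    by (rule algebra_mpoly_algebra)
  define SF where "SF = {squarefree_monom F :: 'k mpoly | F. F \<subseteq> V \<and> F \<notin> \<Delta>}"
  define PP where "PP = {mvar i ^ n i :: 'k mpoly | i. i \<in> V}"
  have I_eq: "?I = (Idl\<^bsub>?P\<^esub> SF) <+>\<^bsub>?P\<^esub> (Idl\<^bsub>?P\<^esub> PP)"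
    by (simp add: artinian_ideal_def stanley_reisner_ideal_def pure_power_ideal_def SF_def PP_def)
  have finV: "finite F" if "F \<subseteq> V" for F
    using fin that by (rule rev_finite_subset)
  have carr: "SF \<subseteq> carrier ?P" "PP \<subseteq> carrier ?P"
    by (auto simp: SF_def PP_def mem_mpoly_algebra_iff squarefree_monom_eq_single mvar_power_eq_single
      keys_squarefree_exponent finV split: if_splits)
  show ideal_I: "ideal ?I ?P"
    unfolding I_eq by (intro P.add_ideals P.genideal_ideal carr)
  have ideal_J: "ideal ?J ?P"
  proof (rule P.ideal_of_closed)
    fix p q assume pq: "p \<in> ?J" "q \<in> ?J"
    then show "p \<oplus>\<^bsub>?P\<^esub> q \<in> ?J"
      using keys_add[of p q] mpoly_closed(1)[of p V q] by auto
  next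
    fix p q assume p: "p \<in> carrier ?P" and q: "q \<in> ?J"
    have "e \<notin> ?B" if e: "e \<in> Poly_Mapping.keys (p * q)" for e
    proof -
      obtain a b where "e = a + b" "b \<in> Poly_Mapping.keys q"
        using keys_mult[of p q] e by auto
      then show ?thesis
        using standard_exponents_mono[OF cplx, of a b n] q by auto
    qed
    then show "p \<otimes>\<^bsub>?P\<^esub> q \<in> ?J"
      using mpoly_closed(2)[OF p, of q] q by auto
  qed (auto simp: mem_mpoly_algebra_iff)
  show "?I = ?J"
  proof
    have "SF \<subseteq> ?J" "PP \<subseteq> ?J"
      using carr by (auto simp: SF_def PP_def squarefree_monom_eq_single mvar_power_eq_single
        keys_squarefree_exponent finV standard_exponents_def)
    then have "Idl\<^bsub>?P\<^esub> SF \<subseteq> ?J" "Idl\<^bsub>?P\<^esub> PP \<subseteq> ?J"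
      by (simp_all only: P.genideal_minimal[OF ideal_J])
    moreover have "\<exists>x\<in>Idl\<^bsub>?P\<^esub> SF. \<exists>y\<in>Idl\<^bsub>?P\<^esub> PP. p = x \<oplus>\<^bsub>?P\<^esub> y" if "p \<in> ?I" for p
      using that unfolding I_eq set_add_defs by auto
    ultimately show "?I \<subseteq> ?J"
      using additive_subgroup.a_closed[OF ideal.axioms(1)[OF ideal_J]] by blast
  next
    have sub: "SF \<subseteq> ?I" "PP \<subseteq> ?I"
    proof -
      interpret S: ideal "Idl\<^bsub>?P\<^esub> SF" ?P by (intro P.genideal_ideal carr)
      interpret T: ideal "Idl\<^bsub>?P\<^esub> PP" ?P by (intro P.genideal_ideal carr)
      have "x + 0 \<in> ?I" if "x \<in> SF" for x
        unfolding I_eq set_add_defs using that P.genideal_self[OF carr(1)] T.zero_closed by force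
      then show "SF \<subseteq> ?I" by auto
      have "0 + x \<in> ?I" if "x \<in> PP" for x
        unfolding I_eq set_add_defs using that P.genideal_self[OF carr(2)] S.zero_closed by force
      then show "PP \<subseteq> ?I" by auto
    qed
    have mono: "Poly_Mapping.single e c \<in> ?I" if e: "Poly_Mapping.keys e \<subseteq> V" "e \<notin> ?B" for e c
    proof -
      \<comment> \<open>\<open>x^a\<close> is a generator dividing \<open>x^e\<close>: if the
        support of \<open>e\<close> is a face, some bound \<open>n i\<close> is violated and a pure
        power divides; otherwise the squarefree monomial of the support does.\<close>
      obtain a where a: "Poly_Mapping.single a 1 \<in> ?I" "\<And>i. Poly_Mapping.lookup a i \<le> Poly_Mapping.lookup e i"
      proof (cases "Poly_Mapping.keys e \<in> \<Delta>")
        case True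
        then obtain i where "i \<in> V" "n i \<le> Poly_Mapping.lookup e i"
          using e by (auto simp: standard_exponents_def not_less)
        then have "Poly_Mapping.single (Poly_Mapping.single i (n i)) 1 \<in> ?I"
          using sub(2) by (auto simp: PP_def mvar_power_eq_single[symmetric])
        then show ?thesis
          by (rule that) (use \<open>n i \<le> _\<close> in \<open>auto simp: lookup_single when_def\<close>)
      next
        case False
        then have "squarefree_monom (Poly_Mapping.keys e) \<in> ?I"
          using sub(1) e(1) by (auto simp: SF_def)
        moreover have "Poly_Mapping.lookup (squarefree_exponent (Poly_Mapping.keys e)) i \<le> Poly_Mapping.lookup e i" for i
          by (simp add: lookup_squarefree_exponent Suc_le_eq in_keys_iff)
        ultimately show ?thesis
          using that by (simp add: squarefree_monom_eq_single)
      qed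
      have ea: "a + (e - a) = e"
        using a(2) by (rule le_exponent_add_diff)
      then have "Poly_Mapping.keys (e - a) \<subseteq> V"
        using e(1) keys_add_nat[of a "e - a"] by auto
      then have "Poly_Mapping.single (e - a) c * Poly_Mapping.single a 1 \<in> ?I"
        using ideal.I_l_closed[OF ideal_I a(1) single_in_mpoly_algebra[of "e - a" V c]] by simp
      then show ?thesis
        by (simp add: mult_single add.commute ea)
    qed
    show "?J \<subseteq> ?I"
    proof
      fix p assume "p \<in> ?J"
      then have "(\<Sum>e\<in>Poly_Mapping.keys p. Poly_Mapping.single e (Poly_Mapping.lookup p e)) \<in> ?I"
        by (intro ideal_sum_closed[OF ideal_I] mono) (auto simp: mem_mpoly_algebra_iff)
      then show "p \<in> ?I"
        by (simp add: sum_single_lookup)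
    qed
  qed
qed

section \<open>Free faces of flag complexes\<close>

text \<open>In the application \<open>C\<close> is the support of a monomial occurring in the image
  of the dual vector at \<open>G\<close>. New vertices extending \<open>C\<close> lie in
  \<open>G\<close> by \<open>link\<close>, so they are pairwise adjacent, and flagness glues them to
  \<open>C\<close> into one face that contains every face above \<open>C\<close>.\<close>

lemma flag_free_face:
  assumes complex: "simplicial_complex_on V \<Delta>" and flag: "flag_complex V \<Delta>"
    and G: "G \<in> \<Delta>" and C: "C \<in> \<Delta>"
    and link: "\<And>i. i \<in> V \<Longrightarrow> i \<notin> G \<Longrightarrow> i \<notin> C \<Longrightarrow> insert i C \<notin> \<Delta>"
  shows "free_face \<Delta> C"
proof -
  have sub: "F \<subseteq> V" if "F \<in> \<Delta>" for F
    using complex that by (auto simp: simplicial_complex_on_def)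
  have down: "F' \<in> \<Delta>" if "F \<in> \<Delta>" "F' \<subseteq> F" for F F'
    using complex that by (auto simp: simplicial_complex_on_def)
  \<comment> \<open>The vertices of all faces above \<open>C\<close>; this becomes the unique facet
    containing \<open>C\<close>.\<close>
  define H where "H = C \<union> {g \<in> G. insert g C \<in> \<Delta>}"
  have edge: "{i, j} \<in> \<Delta>" if ij: "i \<in> H" "j \<in> H" for i j
  proof -
    \<comment> \<open>Two vertices of \<open>H\<close> always lie in a common known face:
      \<open>C\<close>, \<open>G\<close>, or \<open>C\<close> enlarged by one vertex.\<close>
    consider "{i, j} \<subseteq> C" | "{i, j} \<subseteq> G" | "i \<in> C" "insert j C \<in> \<Delta>" | "j \<in> C" "insert i C \<in> \<Delta>"
      using ij unfolding H_def by blast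
    then show ?thesis
      by cases (auto intro: down[OF C] down[OF G] down)
  qed
  \<comment> \<open>The instance \<open>i = j\<close> of \<open>edge\<close> gives
    \<open>{i}\<close> as a face, so every element of \<open>H\<close> is a vertex of the
    skeleton.\<close>
  have "clique_in (skeleton_vertices V \<Delta>) (skeleton_edges \<Delta>) H"
    unfolding clique_in_def skeleton_vertices_def skeleton_edges_def ghost_vertex_def
    using edge sub[OF C] sub[OF G] edge[of i i for i] by (fastforce simp: H_def)
  then have H: "H \<in> \<Delta>"
    using flag by (auto simp: flag_complex_def)
  have max: "F \<subseteq> H" if F: "F \<in> \<Delta>" "C \<subseteq> F" for F
  proof
    fix i assume i: "i \<in> F"
    have "insert i C \<in> \<Delta>"
      using down[OF F(1)] F(2) i by simp
    then show "i \<in> H"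
      using link[of i] sub[OF F(1)] i by (auto simp: H_def)
  qed
  have CH: "C \<subseteq> H"
    by (auto simp: H_def)
  have "facet \<Delta> H"
    using H max CH by (auto simp: facet_def)
  moreover have "F = H" if "facet \<Delta> F" "C \<subseteq> F" for F
    using that max[of F] H by (auto simp: facet_def)
  ultimately show ?thesis
    unfolding free_face_def using C CH by blast
qed

section \<open>Artinian reductions of Stanley--Reisner rings\<close>

locale artinian_stanley_reisner =
  fixes V :: "nat set" and \<Delta> :: "nat set set" and n :: "nat \<Rightarrow> nat"
    and A :: "('k::field, 'k mpoly set) module"
  assumes finite_V: "finite V"
    and complex: "simplicial_complex_on V \<Delta>"
    and exponents: "i \<in> V \<Longrightarrow> n i \<ge> 2"
    and A_eq: "A = artinian_reduction V \<Delta> n"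
begin

abbreviation "P \<equiv> mpoly_algebra V :: ('k, 'k mpoly) module"
abbreviation "K \<equiv> ring_of_type_algebra :: 'k ring"
abbreviation "B \<equiv> standard_exponents V \<Delta> n"
abbreviation "omega \<equiv> canonical_module K A"

section \<open>The quotient map\<close>

definition proj :: "'k mpoly \<Rightarrow> 'k mpoly set" where
  "proj p = artinian_ideal V \<Delta> n +>\<^bsub>P\<^esub> p"

sublocale P: algebra K P
  by (rule algebra_mpoly_algebra)

lemma ideal_artinian: "ideal (artinian_ideal V \<Delta> n) P"
  by (rule artinian_ideal_eq(2)[OF finite_V complex])

sublocale A: algebra K A
  unfolding A_eq artinian_reduction_def
  by (rule algebra_quotient_algebra[OF algebra_mpoly_algebra ideal_artinian])

sublocale omega: module A omega
  by (rule module_canonical_module) (rule A.algebra_axioms)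

lemma face_subset: "F \<in> \<Delta> \<Longrightarrow> F \<subseteq> V"
  using complex by (auto simp: simplicial_complex_on_def)

lemma face_mono: "F \<in> \<Delta> \<Longrightarrow> G \<subseteq> F \<Longrightarrow> G \<in> \<Delta>"
  using complex by (auto simp: simplicial_complex_on_def)

lemma finite_face: "F \<in> \<Delta> \<Longrightarrow> finite F"
  using face_subset finite_V finite_subset by blast

lemma finite_complex: "finite \<Delta>"
  using complex finite_V by (auto simp: simplicial_complex_on_def intro: finite_subset)

lemma ex_facet:
  assumes "F \<in> \<Delta>"
  shows "\<exists>G. facet \<Delta> G \<and> F \<subseteq> G"
proof -
  obtain G where "G \<in> \<Delta>" "F \<subseteq> G" "\<And>H. H \<in> \<Delta> \<Longrightarrow> G \<subseteq> H \<Longrightarrow> H = G"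
    using finite_has_maximal2[OF finite_complex assms] by metis
  then show ?thesis
    by (auto simp: facet_def)
qed

lemma standard_keys: "e \<in> B \<Longrightarrow> Poly_Mapping.keys e \<subseteq> V"
  using face_subset by (auto simp: standard_exponents_def)

lemma finite_B: "finite B"
  by (rule finite_standard_exponents[OF finite_V complex])

lemma proj_closed [simp]: "p \<in> carrier P \<Longrightarrow> proj p \<in> carrier A"
  unfolding A_eq artinian_reduction_def proj_def
  by (auto simp: FactRing_def A_RCOSETS_def')

lemma carrier_A_obtain:
  assumes "y \<in> carrier A"
  obtains p where "p \<in> carrier P" "y = proj p"
  using assms unfolding A_eq artinian_reduction_def proj_def
  by (auto simp: FactRing_def A_RCOSETS_def')

lemma proj_mult: "p \<in> carrier P \<Longrightarrow> q \<in> carrier P \<Longrightarrow> proj p \<otimes>\<^bsub>A\<^esub> proj q = proj (p * q)"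
  unfolding A_eq artinian_reduction_def proj_def
  using ring_hom_mult[OF ideal.rcos_ring_hom[OF ideal_artinian], of p q] by simp

lemma proj_add: "p \<in> carrier P \<Longrightarrow> q \<in> carrier P \<Longrightarrow> proj p \<oplus>\<^bsub>A\<^esub> proj q = proj (p + q)"
  unfolding A_eq artinian_reduction_def proj_def
  using ring_hom_add[OF ideal.rcos_ring_hom[OF ideal_artinian], of p q] by simp

lemma proj_smult: "p \<in> carrier P \<Longrightarrow> c \<odot>\<^bsub>A\<^esub> proj p = proj (Poly_Mapping.single 0 c * p)"
  unfolding A_eq artinian_reduction_def proj_def
  using quotient_algebra_smult[OF algebra_mpoly_algebra ideal_artinian, of c p] by simp

lemma P_zero_closed [simp]: "0 \<in> carrier P"
  by (simp add: mem_mpoly_algebra_iff)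

lemma proj_zero: "proj 0 = \<zero>\<^bsub>A\<^esub>"
proof -
  have "proj 0 \<oplus>\<^bsub>A\<^esub> proj 0 = proj 0"
    by (simp add: proj_add)
  then show ?thesis
    using A.add.r_cancel_one'[of "proj 0" "proj 0"] by simp
qed

text \<open>By the monomial description, \<open>p - q\<close> lies in the ideal iff its standard
  coefficients vanish. Identities in \<open>A\<close> are later checked on standard coefficients in
  this way.\<close>

lemma proj_eq_iff:
  assumes pq: "p \<in> carrier P" "q \<in> carrier P"
  shows "proj p = proj q \<longleftrightarrow> (\<forall>e\<in>B. Poly_Mapping.lookup p e = Poly_Mapping.lookup q e)"
proof -
  have m: "p - q \<in> carrier P"
    using mpoly_closed(1)[OF pq(1) mpoly_uminus_closed[OF pq(2)]] by simp
  have "\<ominus>\<^bsub>P\<^esub> q = - q"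
    using pq by (intro P.minus_equality) (simp_all add: mpoly_uminus_closed)
  then have "proj p = proj q \<longleftrightarrow> p - q \<in> artinian_ideal V \<Delta> n"
    unfolding proj_def using P.quotient_eq_iff_same_a_r_cos[OF ideal_artinian pq]
    by (simp add: a_minus_def)
  also have "\<dots> \<longleftrightarrow> (\<forall>e\<in>B. Poly_Mapping.lookup (p - q) e = 0)"
    using m by (auto simp: artinian_ideal_eq(1)[OF finite_V complex] in_keys_iff simp del: lookup_not_eq_zero_eq_in_keys)
  finally show ?thesis
    by (simp add: lookup_minus)
qed

text \<open>Every class is a finite sum of classes of scaled monomials, so additive properties need
  checking only there. The monomials need not be standard, which allows the rule to run over
  arbitrary monomial scalars.\<close>

lemma proj_induct [consumes 1, case_names single add]:
  assumes y: "y \<in> carrier A"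
    and single: "\<And>a c. Poly_Mapping.keys a \<subseteq> V \<Longrightarrow> Q (proj (Poly_Mapping.single a c))"
    and add: "\<And>y z. y \<in> carrier A \<Longrightarrow> z \<in> carrier A \<Longrightarrow> Q y \<Longrightarrow> Q z \<Longrightarrow> Q (y \<oplus>\<^bsub>A\<^esub> z)"
  shows "Q y"
proof -
  obtain p where p: "p \<in> carrier P" "y = proj p"
    using y by (rule carrier_A_obtain)
  have "(\<Sum>e\<in>S. Poly_Mapping.single e (f e)) \<in> carrier P \<and> Q (proj (\<Sum>e\<in>S. Poly_Mapping.single e (f e)))"
    if "finite S" "\<And>e. e \<in> S \<Longrightarrow> Poly_Mapping.keys e \<subseteq> V" for S f
    using that
  proof (induction S rule: finite_induct)
    case empty
    \<comment> \<open>The empty sum is covered by the monomial case with coefficient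
      \<open>0\<close>.\<close>
    show ?case
      using single[of 0 0] by simp
  next
    case (insert e S)
    let ?s = "\<Sum>e\<in>S. Poly_Mapping.single e (f e)"
    have "Poly_Mapping.single e (f e) \<in> carrier P"
      using insert.prems by (intro single_in_mpoly_algebra) simp
    then show ?case
      using insert add[of "proj (Poly_Mapping.single e (f e))" "proj ?s"] single
      by (auto simp: proj_add mpoly_closed(1))
  qed
  from this[of "Poly_Mapping.keys p" "Poly_Mapping.lookup p"] p show ?thesis
    by (auto simp: sum_single_lookup mem_mpoly_algebra_iff)
qed

section \<open>Coordinates and the dual basis\<close>

text \<open>The value depends on the chosen representative in general; at standard exponents
  \<open>e\<close> it does not, and only these are used.\<close>

definition coef :: "'k mpoly set \<Rightarrow> (nat \<Rightarrow>\<^sub>0 nat) \<Rightarrow> 'k" where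
  "coef y e = Poly_Mapping.lookup (SOME p. p \<in> carrier P \<and> y = proj p) e"

lemma coef_proj:
  assumes "p \<in> carrier P" "e \<in> B"
  shows "coef (proj p) e = Poly_Mapping.lookup p e"
proof -
  let ?q = "SOME q. q \<in> carrier P \<and> proj p = proj q"
  have "?q \<in> carrier P \<and> proj p = proj ?q"
    by (rule someI) (use assms in blast)
  then show ?thesis
    using assms proj_eq_iff[of p ?q] by (simp add: coef_def)
qed

definition rmonom :: "(nat \<Rightarrow>\<^sub>0 nat) \<Rightarrow> 'k mpoly set" where
  "rmonom e = proj (Poly_Mapping.single e 1)"

lemma rmonom_closed [simp]: "Poly_Mapping.keys e \<subseteq> V \<Longrightarrow> rmonom e \<in> carrier A"
  by (simp add: rmonom_def single_in_mpoly_algebra)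

lemma rmonom_eq_zero:
  assumes "Poly_Mapping.keys e \<subseteq> V" "e \<notin> B"
  shows "rmonom e = \<zero>\<^bsub>A\<^esub>"
  unfolding rmonom_def proj_zero[symmetric]
  using assms by (subst proj_eq_iff) (auto simp: single_in_mpoly_algebra lookup_single when_def)

lemma proj_single: "Poly_Mapping.keys e \<subseteq> V \<Longrightarrow> proj (Poly_Mapping.single e c) = c \<odot>\<^bsub>A\<^esub> rmonom e"
  by (simp add: rmonom_def proj_smult single_in_mpoly_algebra mult_single)

text \<open>The dual basis vector of \<open>x^b\<close>, for standard \<open>b\<close>. The
  restriction makes it extensional, as \<open>module_hom\<close> demands.\<close>

definition dual :: "(nat \<Rightarrow>\<^sub>0 nat) \<Rightarrow> 'k mpoly set \<Rightarrow> 'k" where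
  "dual b = (\<lambda>y\<in>carrier A. coef y b)"

lemma omegaD:
  assumes "l \<in> carrier omega"
  shows "y \<in> carrier A \<Longrightarrow> z \<in> carrier A \<Longrightarrow> l (y \<oplus>\<^bsub>A\<^esub> z) = l y + l z"
    and "y \<in> carrier A \<Longrightarrow> l (c \<odot>\<^bsub>A\<^esub> y) = c * l y"
    and "l \<zero>\<^bsub>A\<^esub> = 0"
proof -
  note l = assms[simplified canonical_module_simps]
  show "y \<in> carrier A \<Longrightarrow> z \<in> carrier A \<Longrightarrow> l (y \<oplus>\<^bsub>A\<^esub> z) = l y + l z"
    using module_homD(3)[OF l] by simp
  show *: "y \<in> carrier A \<Longrightarrow> l (c \<odot>\<^bsub>A\<^esub> y) = c * l y" for c y
    using module_homD(4)[OF l] by simp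
  show "l \<zero>\<^bsub>A\<^esub> = 0"
    using *[of "\<zero>\<^bsub>A\<^esub>" 0] by simp
qed

lemma dual_closed: "b \<in> B \<Longrightarrow> dual b \<in> carrier omega"
  unfolding canonical_module_simps
proof (rule module_homI)
  assume b: "b \<in> B"
  show "dual b (y \<oplus>\<^bsub>A\<^esub> z) = dual b y \<oplus>\<^bsub>regular_module K\<^esub> dual b z"
    if "y \<in> carrier A" "z \<in> carrier A" for y z
    using that b by (elim carrier_A_obtain) (simp add: dual_def proj_add coef_proj mpoly_closed lookup_add)
  show "dual b (c \<odot>\<^bsub>A\<^esub> y) = c \<odot>\<^bsub>regular_module K\<^esub> dual b y"
    if "c \<in> carrier K" "y \<in> carrier A" for c y
    using that b lookup_single_mult_add[of 0 c _ b]
    by (elim carrier_A_obtain)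
      (simp add: dual_def proj_smult coef_proj mpoly_closed single_in_mpoly_algebra)
qed (simp add: dual_def)

text \<open>Multiplication by \<open>x^a\<close> moves the coefficient at \<open>b\<close> to
  \<open>a + b\<close>, so dually \<open>x^a\<close> takes the dual vector at \<open>a + b\<close>
  to the one at \<open>b\<close>.\<close>

lemma smult_dual:
  assumes "a + b \<in> B" "y \<in> carrier A"
  shows "(proj (Poly_Mapping.single a c) \<odot>\<^bsub>omega\<^esub> dual (a + b)) y = c * coef y b"
proof -
  have "Poly_Mapping.keys a \<subseteq> V" "b \<in> B"
    using standard_keys[OF assms(1)] standard_exponents_mono[OF complex assms(1)]
    by (auto simp: keys_add_nat)
  with assms show ?thesis
    by (elim carrier_A_obtain) (simp add: dual_def proj_mult single_in_mpoly_algebra mpoly_closed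
      coef_proj lookup_single_mult_add)
qed

text \<open>When \<open>x^a\<close> does not divide \<open>x^b\<close>, no multiple of
  \<open>x^a\<close> has a term \<open>x^b\<close>.\<close>

lemma smult_dual_eq_zero:
  assumes "b \<in> B" "Poly_Mapping.keys a \<subseteq> V" "\<And>t. b \<noteq> a + t"
  shows "rmonom a \<odot>\<^bsub>omega\<^esub> dual b = \<zero>\<^bsub>omega\<^esub>"
  unfolding canonical_module_simps
proof (rule restrict_ext)
  show "dual b (rmonom a \<otimes>\<^bsub>A\<^esub> y) = \<zero>\<^bsub>K\<^esub>" if "y \<in> carrier A" for y
    using that assms
    by (elim carrier_A_obtain) (simp add: dual_def rmonom_def proj_mult single_in_mpoly_algebra mpoly_closed
      coef_proj lookup_single_mult_eq_0)
qed

text \<open>The exponent of \<open>s\<^sub>G\<close>, the largest standard exponent supported in the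
  face \<open>G\<close>; for a facet \<open>G\<close> it belongs to a socle monomial.\<close>

definition top_exponent :: "nat set \<Rightarrow> nat \<Rightarrow>\<^sub>0 nat" where
  "top_exponent G = (\<Sum>i\<in>G. Poly_Mapping.single i (n i - 1))"

lemma lookup_top_exponent:
  "G \<in> \<Delta> \<Longrightarrow> Poly_Mapping.lookup (top_exponent G) i = (if i \<in> G then n i - 1 else 0)"
  unfolding top_exponent_def by (rule lookup_sum_single) (rule finite_face)

lemma top_exponent_standard:
  assumes "G \<in> \<Delta>"
  shows "top_exponent G \<in> B"
proof -
  have "n i > 0" if "i \<in> V" for i
    using exponents[OF that] by simp
  moreover have "Poly_Mapping.keys (top_exponent G) \<subseteq> G"
    using assms by (intro keys_subsetI) (simp add: lookup_top_exponent split: if_splits)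
  ultimately show ?thesis
    using face_mono[OF assms] by (auto simp: standard_exponents_def lookup_top_exponent assms)
qed

lemma lookup_standard_eq_0:
  "e \<in> B \<Longrightarrow> Poly_Mapping.keys e \<subseteq> G \<Longrightarrow> i \<notin> G \<Longrightarrow> Poly_Mapping.lookup e i = 0"
  by (auto simp: in_keys_iff)

lemma standard_le_top_exponent:
  assumes "e \<in> B" "Poly_Mapping.keys e \<subseteq> G" "G \<in> \<Delta>"
  shows "Poly_Mapping.lookup e i \<le> Poly_Mapping.lookup (top_exponent G) i"
proof (cases "i \<in> G")
  case True
  then have "i \<in> V"
    using face_subset[OF assms(3)] by auto
  then have "Poly_Mapping.lookup e i < n i"
    using assms(1) by (simp add: standard_exponents_def)
  then show ?thesis
    using True assms(3) by (simp add: lookup_top_exponent)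
qed (use lookup_standard_eq_0[OF assms(1,2)] in simp)

section \<open>The ideal of the free faces\<close>

definition free_ideal :: "'k mpoly set set" where
  "free_ideal = Idl\<^bsub>A\<^esub> {residue_monom V \<Delta> n F | F. free_face \<Delta> F}"

text \<open>A face above \<open>F\<close> extends to a facet, which also contains \<open>F\<close>
  and so equals \<open>G\<close>. Uniqueness among facets thus becomes a bound for all faces above
  \<open>F\<close>.\<close>

lemma free_face_facet:
  assumes "free_face \<Delta> F"
  obtains G where "facet \<Delta> G" "F \<subseteq> G" "\<And>H. H \<in> \<Delta> \<Longrightarrow> F \<subseteq> H \<Longrightarrow> H \<subseteq> G"
proof -
  obtain G where G: "facet \<Delta> G" "F \<subseteq> G" and uniq: "\<And>H. facet \<Delta> H \<Longrightarrow> F \<subseteq> H \<Longrightarrow> H = G"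
    using assms by (auto simp: free_face_def)
  have "H \<subseteq> G" if "H \<in> \<Delta>" "F \<subseteq> H" for H
    using ex_facet[OF that(1)] uniq that(2) by blast
  with G that show ?thesis by blast
qed

lemma free_face_in_complex: "free_face \<Delta> F \<Longrightarrow> F \<in> \<Delta>"
  by (simp add: free_face_def)

lemma residue_monom_eq:
  "residue_monom V \<Delta> n F = rmonom (squarefree_exponent F)"
  by (simp add: residue_monom_def rmonom_def proj_def squarefree_monom_eq_single)

lemma residue_monom_closed: "F \<in> \<Delta> \<Longrightarrow> residue_monom V \<Delta> n F \<in> carrier A"
  using face_subset finite_face by (simp add: residue_monom_eq keys_squarefree_exponent)

lemma ideal_free_ideal: "ideal free_ideal A"
  unfolding free_ideal_def
  by (rule A.genideal_ideal) (auto dest: free_face_in_complex residue_monom_closed)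

lemma residue_monom_in_free_ideal: "free_face \<Delta> F \<Longrightarrow> residue_monom V \<Delta> n F \<in> free_ideal"
  unfolding free_ideal_def
  using A.genideal_self[of "{residue_monom V \<Delta> n F | F. free_face \<Delta> F}"]
  by (auto dest: free_face_in_complex residue_monom_closed)

text \<open>A monomial is a multiple of the squarefree monomial of its support.\<close>

lemma single_in_free_ideal:
  assumes "free_face \<Delta> (Poly_Mapping.keys e)"
  shows "proj (Poly_Mapping.single e c) \<in> free_ideal"
proof -
  let ?F = "Poly_Mapping.keys e"
  let ?d = "e - squarefree_exponent ?F"
  have V: "?F \<subseteq> V"
    using assms free_face_in_complex face_subset by blast
  have e: "squarefree_exponent ?F + ?d = e"
    by (rule le_exponent_add_diff) (simp add: lookup_squarefree_exponent Suc_le_eq in_keys_iff)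
  have "Poly_Mapping.keys ?d \<subseteq> Poly_Mapping.keys (squarefree_exponent ?F + ?d)"
    unfolding keys_add_nat by blast
  then have d: "Poly_Mapping.keys ?d \<subseteq> V"
    using V by (simp add: e)
  have "proj (Poly_Mapping.single ?d c) \<otimes>\<^bsub>A\<^esub> residue_monom V \<Delta> n ?F \<in> free_ideal"
    using d by (intro ideal.I_l_closed[OF ideal_free_ideal] residue_monom_in_free_ideal assms)
      (simp add: single_in_mpoly_algebra)
  then show ?thesis
    using V d e by (simp add: residue_monom_eq rmonom_def proj_mult single_in_mpoly_algebra
      keys_squarefree_exponent mult_single add.commute)
qed

lemma proj_in_free_ideal:
  assumes p: "p \<in> carrier P"
    and free: "\<And>e. e \<in> B \<Longrightarrow> Poly_Mapping.lookup p e \<noteq> 0 \<Longrightarrow> free_face \<Delta> (Poly_Mapping.keys e)"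
  shows "proj p \<in> free_ideal"
proof -
  let ?s = "\<lambda>S. \<Sum>e\<in>S. Poly_Mapping.single e (Poly_Mapping.lookup p e)"
  have *: "?s S \<in> carrier P \<and> proj (?s S) \<in> free_ideal" if "finite S" "S \<subseteq> B" for S
    using that
  proof (induction S rule: finite_induct)
    case empty
    then show ?case
      using additive_subgroup.zero_closed[OF ideal.axioms(1)[OF ideal_free_ideal]]
      by (simp add: proj_zero)
  next
    case (insert e S)
    let ?e = "Poly_Mapping.single e (Poly_Mapping.lookup p e)"
    have e: "?e \<in> carrier P"
      using insert.prems standard_keys by (intro single_in_mpoly_algebra) auto
    have "proj ?e \<in> free_ideal"
    proof (cases "Poly_Mapping.lookup p e = 0")
      case True
      then show ?thesis
        using additive_subgroup.zero_closed[OF ideal.axioms(1)[OF ideal_free_ideal]]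
        by (simp add: proj_zero)
    next
      case False
      then show ?thesis
        using insert.prems by (intro single_in_free_ideal free) auto
    qed
    then show ?case
      using insert e additive_subgroup.a_closed[OF ideal.axioms(1)[OF ideal_free_ideal], of "proj ?e" "proj (?s S)"]
      by (simp add: proj_add mpoly_closed(1))
  qed
  \<comment> \<open>The nonstandard terms of \<open>p\<close> vanish in \<open>A\<close>, so the
    standard part represents the same class.\<close>
  have "proj p = proj (?s B)"
    using p *[OF finite_B subset_refl] by (subst proj_eq_iff) (simp_all add: lookup_sum_single finite_B)
  then show ?thesis
    using *[OF finite_B] by simp
qed

section \<open>The trace lies in the ideal of the free faces\<close>

text \<open>For \<open>i\<close> outside \<open>G\<close> the variable \<open>x_i\<close> does not
  divide \<open>s\<^sub>G\<close>, so it kills the dual vector and hence its image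
  \<open>proj p\<close>. Reading off the coefficient of \<open>x_i x^e\<close> gives the hypothesis
  \<open>link\<close> of \<open>flag_free_face\<close> for the support of \<open>e\<close>.\<close>

lemma image_dual_top_in_free_ideal:
  assumes flag: "flag_complex V \<Delta>" and G: "G \<in> \<Delta>"
    and phi: "\<phi> \<in> module_hom A omega (regular_module A)"
  shows "\<phi> (dual (top_exponent G)) \<in> free_ideal"
proof -
  let ?l = "dual (top_exponent G)"
  have l: "?l \<in> carrier omega"
    by (intro dual_closed top_exponent_standard G)
  have phi0: "\<phi> \<zero>\<^bsub>omega\<^esub> = \<zero>\<^bsub>A\<^esub>"
    using omega.module_axioms phi by (rule module_hom_zero)
  obtain p where p: "p \<in> carrier P" "\<phi> ?l = proj p"
    using module_homD(2)[OF phi l] by (auto elim: carrier_A_obtain)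
  have "free_face \<Delta> (Poly_Mapping.keys e)" if e: "e \<in> B" and pe: "Poly_Mapping.lookup p e \<noteq> 0" for e
  proof (rule flag_free_face[OF complex flag G])
    show "Poly_Mapping.keys e \<in> \<Delta>"
      using e by (simp add: standard_exponents_def)
    fix i assume i: "i \<in> V" "i \<notin> G" "i \<notin> Poly_Mapping.keys e"
    let ?x = "Poly_Mapping.single i (1::nat)"
    have x: "Poly_Mapping.keys ?x \<subseteq> V"
      using i by simp
    have "top_exponent G \<noteq> ?x + t" for t
    proof
      assume "top_exponent G = ?x + t"
      then have "Poly_Mapping.lookup (top_exponent G) i = Poly_Mapping.lookup (?x + t) i"
        by simp
      then show False
        using i(2) by (simp add: lookup_top_exponent[OF G] lookup_add)
    qed
    then have "rmonom ?x \<odot>\<^bsub>omega\<^esub> ?l = \<zero>\<^bsub>omega\<^esub>"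
      by (intro smult_dual_eq_zero top_exponent_standard G x)
    then have "rmonom ?x \<otimes>\<^bsub>A\<^esub> proj p = \<zero>\<^bsub>A\<^esub>"
      using module_homD(4)[OF phi rmonom_closed[OF x] l] phi0 p by (simp del: canonical_module_simps)
    then have zero: "\<forall>t\<in>B. Poly_Mapping.lookup (Poly_Mapping.single ?x 1 * p) t = 0"
      using p x by (simp add: rmonom_def proj_mult single_in_mpoly_algebra proj_zero[symmetric] proj_eq_iff mpoly_closed)
    show "insert i (Poly_Mapping.keys e) \<notin> \<Delta>"
    proof
      assume "insert i (Poly_Mapping.keys e) \<in> \<Delta>"
      \<comment> \<open>The exponent at \<open>i\<close> rises from 0 to 1, still below
        \<open>n i\<close> because \<open>n i \<ge> 2\<close>; so only the support decides whether
        \<open>?x + e\<close> is standard.\<close>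
      then have "?x + e \<in> B"
        using e i exponents[OF i(1)]
        by (auto simp: standard_exponents_def keys_add_nat lookup_add lookup_single when_def in_keys_iff)
      then show False
        using zero pe lookup_single_mult_add[of ?x 1 p e] by auto
    qed
  qed
  then show ?thesis
    using proj_in_free_ideal p by simp
qed

text \<open>Both sides are additive in \<open>y\<close>, so monomials suffice. For nonstandard
  \<open>a\<close> the left side vanishes because \<open>x^a\<close> is zero in \<open>A\<close>,
  and the sum has no nonzero term.\<close>

lemma linear_form_expansion:
  assumes l: "l \<in> carrier omega" and y: "y \<in> carrier A"
  shows "l y = (\<Sum>b\<in>B. l (rmonom b) * coef y b)"
  using y
proof (induction rule: proj_induct)
  case (single a c)
  have "l (proj (Poly_Mapping.single a c)) = c * l (rmonom a)"
    using single omegaD(2)[OF l] by (simp add: proj_single)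
  moreover have "(\<Sum>b\<in>B. l (rmonom b) * coef (proj (Poly_Mapping.single a c)) b) =
      (\<Sum>b\<in>B. if b = a then l (rmonom a) * c else 0)"
    using single by (intro sum.cong) (auto simp: coef_proj single_in_mpoly_algebra lookup_single when_def)
  ultimately show ?case
    using single finite_B rmonom_eq_zero[OF single] omegaD(3)[OF l] by auto
next
  case (add y z)
  have "coef (y \<oplus>\<^bsub>A\<^esub> z) b = coef y b + coef z b" if "b \<in> B" for b
    using add(1,2) that
    by (elim carrier_A_obtain) (simp add: proj_add coef_proj mpoly_closed lookup_add)
  then show ?case
    using add omegaD(1)[OF l] by (simp add: distrib_left sum.distrib)
qed

text \<open>Each dual basis vector is a monomial multiple of the dual vector of some
  \<open>s\<^sub>G\<close>. So \<open>\<phi> l\<close> is an \<open>A\<close>-linear combination of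
  elements already known to lie in the ideal.\<close>

lemma image_in_free_ideal:
  assumes flag: "flag_complex V \<Delta>" and l: "l \<in> carrier omega"
    and phi: "\<phi> \<in> module_hom A omega (regular_module A)"
  shows "\<phi> l \<in> free_ideal"
proof -
  \<comment> \<open>Partial sums of the dual basis expansion of \<open>l\<close>, restricted so that
    each is itself an element of \<open>omega\<close>.\<close>
  let ?l = "\<lambda>S. \<lambda>y\<in>carrier A. \<Sum>b\<in>S. l (rmonom b) * coef y b"
  have partial: "?l S \<in> carrier omega \<and> \<phi> (?l S) \<in> free_ideal" if "finite S" "S \<subseteq> B" for S
    using that
  proof (induction S rule: finite_induct)
    case empty
    have z: "?l {} = \<zero>\<^bsub>omega\<^esub>"
      by simp
    have "\<phi> \<zero>\<^bsub>omega\<^esub> = \<zero>\<^bsub>A\<^esub>"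
      using omega.module_axioms phi by (rule module_hom_zero)
    then show ?case
      unfolding z using omega.M.zero_closed
        additive_subgroup.zero_closed[OF ideal.axioms(1)[OF ideal_free_ideal]]
      by (simp del: canonical_module_simps)
  next
    case (insert b S)
    have b: "b \<in> B"
      using insert.prems by simp
    have IH: "?l S \<in> carrier omega" "\<phi> (?l S) \<in> free_ideal"
      using insert.IH insert.prems by blast+
    obtain G where G: "G \<in> \<Delta>" "Poly_Mapping.keys b \<subseteq> G"
      using b by (auto simp: standard_exponents_def)
    \<comment> \<open>\<open>?d\<close> is the exponent of \<open>s\<^sub>G / x^b\<close>:
      multiplying the dual vector of \<open>s\<^sub>G\<close> by that monomial gives the one of
      \<open>x^b\<close>. The scalar \<open>l (rmonom b)\<close> is absorbed into the monomial
      \<open>?a\<close> below.\<close>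
    let ?t = "top_exponent G" and ?d = "top_exponent G - b"
    have t: "?d + b = ?t"
      using le_exponent_add_diff[of b ?t] standard_le_top_exponent[OF b G(2,1)] by (simp add: add.commute)
    have tB: "?t \<in> B"
      using G(1) by (rule top_exponent_standard)
    have "Poly_Mapping.keys ?d \<subseteq> V"
      using standard_keys[OF tB] keys_add_nat[of ?d b] t by simp
    then have a: "proj (Poly_Mapping.single ?d (l (rmonom b))) \<in> carrier A" (is "?a \<in> _")
      by (simp add: single_in_mpoly_algebra)
    have D: "dual ?t \<in> carrier omega"
      using tB by (rule dual_closed)
    have m: "?a \<odot>\<^bsub>omega\<^esub> dual ?t \<in> carrier omega"
      using a D by (rule omega.smult_closed)
    have "?l (insert b S) = (?a \<odot>\<^bsub>omega\<^esub> dual ?t) \<oplus>\<^bsub>omega\<^esub> ?l S"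
      unfolding canonical_module_simps(3)
      using insert.hyps smult_dual[of ?d b _ "l (rmonom b)"] tB t
      by (intro restrict_ext) (simp del: canonical_module_simps)
    moreover have "\<phi> ((?a \<odot>\<^bsub>omega\<^esub> dual ?t) \<oplus>\<^bsub>omega\<^esub> ?l S) = ?a \<otimes>\<^bsub>A\<^esub> \<phi> (dual ?t) \<oplus>\<^bsub>A\<^esub> \<phi> (?l S)"
      using module_homD(3)[OF phi m IH(1)] module_homD(4)[OF phi a D]
      by (simp del: canonical_module_simps)
    moreover have "?a \<otimes>\<^bsub>A\<^esub> \<phi> (dual ?t) \<in> free_ideal"
      by (intro ideal.I_l_closed[OF ideal_free_ideal] image_dual_top_in_free_ideal flag G(1) phi a)
    ultimately show ?case
      using IH omega.M.a_closed[OF m IH(1)]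
        additive_subgroup.a_closed[OF ideal.axioms(1)[OF ideal_free_ideal], of "?a \<otimes>\<^bsub>A\<^esub> \<phi> (dual ?t)" "\<phi> (?l S)"]
      by (simp only:)
  qed
  have "?l B = l"
  proof (rule ext)
    fix y show "?l B y = l y"
      using linear_form_expansion[OF l] module_homD(1)[OF l[unfolded canonical_module_simps]]
      by (auto simp: PiE_def extensional_def)
  qed
  then show ?thesis
    using partial[OF finite_B subset_refl] by (simp only:)
qed

lemma canonical_trace_subset:
  assumes flag: "flag_complex V \<Delta>"
  shows "canonical_trace K A \<subseteq> free_ideal"
proof
  fix y assume "y \<in> canonical_trace K A"
  then obtain S w where S: "finite S" "S \<subseteq> module_hom A omega (regular_module A)"
      "w \<in> S \<rightarrow> carrier omega" and y: "y = (\<Oplus>\<^bsub>A\<^esub>\<phi>\<in>S. \<phi> (w \<phi>))"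
    by (auto simp: canonical_trace_def module_trace_def simp del: canonical_module_simps)
  have "(\<Oplus>\<^bsub>A\<^esub>\<phi>\<in>S. \<phi> (w \<phi>)) \<in> free_ideal"
    using S
  proof (induction S rule: finite_induct)
    case empty
    then show ?case
      using additive_subgroup.zero_closed[OF ideal.axioms(1)[OF ideal_free_ideal]] by simp
  next
    case (insert \<phi> S)
    have mem: "\<psi> (w \<psi>) \<in> free_ideal" if "\<psi> \<in> insert \<phi> S" for \<psi>
      using insert.prems that by (intro image_in_free_ideal[OF flag]) auto
    have "(\<Oplus>\<^bsub>A\<^esub>\<phi>\<in>insert \<phi> S. \<phi> (w \<phi>)) = \<phi> (w \<phi>) \<oplus>\<^bsub>A\<^esub> (\<Oplus>\<^bsub>A\<^esub>\<phi>\<in>S. \<phi> (w \<phi>))"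
      using insert.hyps mem ideal.Icarr[OF ideal_free_ideal] by (intro A.M.finsum_insert) auto
    then show ?case
      using insert mem additive_subgroup.a_closed[OF ideal.axioms(1)[OF ideal_free_ideal]] by simp
  qed
  then show "y \<in> free_ideal"
    by (simp add: y)
qed

section \<open>Free faces give elements of the trace\<close>

text \<open>
  \<open>T\<close> consists of the exponents of the standard monomials divisible by \<open>x\<^sub>F\<close>. Since \<open>u\<close> is the
  exponent of \<open>x\<^sub>F s\<^sub>G\<close>, the reflection \<open>t\<close> \<open>\<mapsto>\<close> \<open>u - t\<close> gives the dual basis vector that is
  sent to \<open>x\<^sup>t\<close>.
\<close>

context
  fixes F G :: "nat set" and u :: "nat \<Rightarrow>\<^sub>0 nat" and T :: "(nat \<Rightarrow>\<^sub>0 nat) set"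
  assumes F: "F \<in> \<Delta>" and G: "facet \<Delta> G" "F \<subseteq> G"
    and uniq: "\<And>H. H \<in> \<Delta> \<Longrightarrow> F \<subseteq> H \<Longrightarrow> H \<subseteq> G"
    and u_def: "u = top_exponent G + squarefree_exponent F"
    and T_def: "T = {t \<in> B. F \<subseteq> Poly_Mapping.keys t}"
begin

lemma G_face: "G \<in> \<Delta>"
  using G by (simp add: facet_def)

text \<open>On \<open>F\<close> the two summands add up to \<open>n i\<close>, one beyond the
  standard range. This excess keeps \<open>u - t\<close> positive on \<open>F\<close> for every
  \<open>t\<close> in \<open>T\<close>.\<close>

lemma lookup_u: "Poly_Mapping.lookup u i = (if i \<in> G then n i - 1 else 0) + (if i \<in> F then 1 else 0)"
  using G_face finite_face[OF F] by (simp add: u_def lookup_add lookup_top_exponent lookup_squarefree_exponent)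

lemma keys_u: "Poly_Mapping.keys u \<subseteq> V"
  using standard_keys[OF top_exponent_standard[OF G_face]] face_subset[OF F] finite_face[OF F]
  by (simp add: u_def keys_add_nat keys_squarefree_exponent)

lemma T_standard: "t \<in> T \<Longrightarrow> t \<in> B"
  by (simp add: T_def)

lemma finite_T: "finite T"
  using finite_B by (simp add: T_def)

text \<open>The support of \<open>t\<close> is a face above \<open>F\<close>, so \<open>uniq\<close>
  applies.\<close>

lemma keys_T: "t \<in> T \<Longrightarrow> Poly_Mapping.keys t \<subseteq> G"
  using uniq by (auto simp: T_def standard_exponents_def)

lemma T_le_u:
  assumes "t \<in> T"
  shows "Poly_Mapping.lookup t i \<le> Poly_Mapping.lookup u i"
  using standard_le_top_exponent[OF T_standard[OF assms] keys_T[OF assms] G_face, of i]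
  by (simp add: u_def lookup_add)

lemma keys_u_diff: "t \<in> T \<Longrightarrow> Poly_Mapping.keys (u - t) \<subseteq> V"
proof -
  have "Poly_Mapping.keys (u - t) \<subseteq> Poly_Mapping.keys u"
    by (intro keys_subsetI) (simp add: lookup_minus flip: lookup_not_eq_zero_eq_in_keys)
  then show ?thesis
    using keys_u by simp
qed

lemma T_add:
  assumes "s \<in> T" "a + s \<in> B"
  shows "a + s \<in> T"
  using assms by (auto simp: T_def keys_add_nat)

lemma u_diff_add:
  assumes "s \<in> T" "a + s \<in> B"
  shows "a + (u - (a + s)) = u - s"
proof (rule poly_mapping_eqI)
  fix i show "Poly_Mapping.lookup (a + (u - (a + s))) i = Poly_Mapping.lookup (u - s) i"
    using T_le_u[OF T_add[OF assms], of i] by (simp add: lookup_add lookup_minus)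
qed

text \<open>Used contrapositively for linearity: if \<open>t\<close> is not \<open>a + s\<close>
  with \<open>s\<close> in \<open>T\<close>, then \<open>x^a x^(u - t)\<close> is zero in
  \<open>A\<close>, so every linear form vanishes on it.\<close>

lemma T_of_standard:
  assumes t: "t \<in> T" and B: "a + (u - t) \<in> B"
  shows "\<exists>s\<in>T. t = a + s"
proof -
  have less: "Poly_Mapping.lookup a i + (Poly_Mapping.lookup u i - Poly_Mapping.lookup t i) < n i" if "i \<in> V" for i
    using B that by (auto simp: standard_exponents_def lookup_add lookup_minus)
  have tn: "Poly_Mapping.lookup t i < n i" if "i \<in> V" for i
    using T_standard[OF t] that by (simp add: standard_exponents_def)
  have FV: "i \<in> V" if "i \<in> F" for i
    using face_subset[OF F] that by auto
  \<comment> \<open>On \<open>F\<close> the value of \<open>u\<close> is \<open>n i\<close>, which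
    exceeds that of the standard exponent \<open>t\<close>. The support is then a face above
    \<open>F\<close>, hence contained in \<open>G\<close>.\<close>
  have "F \<subseteq> Poly_Mapping.keys (a + (u - t))"
  proof
    fix i assume i: "i \<in> F"
    then have "Poly_Mapping.lookup t i < Poly_Mapping.lookup u i"
      using tn[OF FV[OF i]] G(2) by (auto simp: lookup_u)
    then show "i \<in> Poly_Mapping.keys (a + (u - t))"
      by (simp add: lookup_add lookup_minus flip: lookup_not_eq_zero_eq_in_keys)
  qed
  then have aG: "Poly_Mapping.keys a \<subseteq> G"
    using uniq[of "Poly_Mapping.keys (a + (u - t))"] B by (simp add: standard_exponents_def keys_add_nat)
  \<comment> \<open>On \<open>G\<close> the value of \<open>u\<close> is \<open>n i - 1\<close>
    outside \<open>F\<close> and \<open>n i\<close> on \<open>F\<close>. So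
    \<open>a + (u - t) < n i\<close> yields \<open>a \<le> t\<close>, and \<open>a < t\<close> on
    \<open>F\<close>; the strict bound puts \<open>F\<close> into the support of
    \<open>t - a\<close>.\<close>
  have le: "Poly_Mapping.lookup a i \<le> Poly_Mapping.lookup t i"
    and lt: "i \<in> F \<Longrightarrow> Poly_Mapping.lookup a i < Poly_Mapping.lookup t i" for i
  proof -
    show "Poly_Mapping.lookup a i \<le> Poly_Mapping.lookup t i"
    proof (cases "i \<in> G")
      case True
      then have "i \<in> V"
        using face_subset[OF G_face] by auto
      then show ?thesis
        using less[of i] T_le_u[OF t, of i] True by (auto simp: lookup_u split: if_splits)
    next
      case False
      then have "i \<notin> Poly_Mapping.keys a"
        using aG by auto
      then show ?thesis
        by (simp add: in_keys_iff)
    qed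
    show "Poly_Mapping.lookup a i < Poly_Mapping.lookup t i" if "i \<in> F"
      using less[OF FV[OF that]] T_le_u[OF t, of i] that G(2) by (auto simp: lookup_u)
  qed
  have s: "a + (t - a) = t"
    using le by (rule le_exponent_add_diff)
  have "t - a \<in> B"
    using standard_exponents_mono[OF complex, of a "t - a" n] T_standard[OF t] s by simp
  moreover have "F \<subseteq> Poly_Mapping.keys (t - a)"
    using lt by (intro subsetI) (simp add: lookup_minus not_le flip: lookup_not_eq_zero_eq_in_keys)
  ultimately show ?thesis
    using s by (intro bexI[of _ "t - a"]) (simp_all add: T_def)
qed

text \<open>A polynomial representing the image of \<open>l\<close>: the coordinate of
  \<open>l\<close> at the dual vector of \<open>x^(u - t)\<close> becomes the coefficient of
  \<open>x^t\<close>.\<close>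

definition free_poly :: "('k mpoly set \<Rightarrow> 'k) \<Rightarrow> 'k mpoly" where
  "free_poly l = (\<Sum>t\<in>T. Poly_Mapping.single t (l (rmonom (u - t))))"

lemma free_poly_closed: "free_poly l \<in> carrier P"
  unfolding free_poly_def using standard_keys[OF T_standard]
  by (intro mpoly_sum_closed single_in_mpoly_algebra)

lemma lookup_free_poly:
  "Poly_Mapping.lookup (free_poly l) t = (if t \<in> T then l (rmonom (u - t)) else 0)"
  unfolding free_poly_def by (rule lookup_sum_single[OF finite_T])

text \<open>Compare coefficients at a standard \<open>t\<close>. If \<open>t = a + s\<close> with
  \<open>s\<close> in \<open>T\<close>, then \<open>a + (u - t) = u - s\<close> and both sides
  agree. Otherwise the right side vanishes because \<open>free_poly l\<close> is supported on
  \<open>T\<close>, and the left side by \<open>T_of_standard\<close>.\<close>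

lemma free_poly_smult_single:
  assumes l: "l \<in> carrier omega" and a: "Poly_Mapping.keys a \<subseteq> V"
  shows "proj (free_poly (proj (Poly_Mapping.single a c) \<odot>\<^bsub>omega\<^esub> l)) =
    proj (Poly_Mapping.single a c) \<otimes>\<^bsub>A\<^esub> proj (free_poly l)"
proof -
  have ev: "(proj (Poly_Mapping.single a c) \<odot>\<^bsub>omega\<^esub> l) (rmonom (u - t)) = c * l (rmonom (a + (u - t)))"
    if "t \<in> T" for t
  proof -
    have k: "Poly_Mapping.keys (a + (u - t)) \<subseteq> V"
      using a keys_u_diff[OF that] by (simp add: keys_add_nat)
    have "proj (Poly_Mapping.single a c) \<otimes>\<^bsub>A\<^esub> rmonom (u - t) = c \<odot>\<^bsub>A\<^esub> rmonom (a + (u - t))"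
      using a keys_u_diff[OF that]
      by (simp add: rmonom_def proj_mult single_in_mpoly_algebra mult_single proj_single[OF k, unfolded rmonom_def, symmetric])
    then show ?thesis
      using omegaD(2)[OF l rmonom_closed[OF k]] rmonom_closed[OF keys_u_diff[OF that]] by simp
  qed
  have eq: "Poly_Mapping.lookup (free_poly (proj (Poly_Mapping.single a c) \<odot>\<^bsub>omega\<^esub> l)) t =
      Poly_Mapping.lookup (Poly_Mapping.single a c * free_poly l) t" if t: "t \<in> B" for t
  proof (cases "\<exists>s\<in>T. t = a + s")
    case True
    then obtain s where s: "s \<in> T" "t = a + s"
      by blast
    then have "t \<in> T"
      using T_add t by simp
    then show ?thesis
      using s t u_diff_add[of s a]
      by (simp add: lookup_free_poly ev lookup_single_mult_add del: canonical_module_simps)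
  next
    case False
    have "Poly_Mapping.lookup (Poly_Mapping.single a c * free_poly l) t = 0"
    proof (cases "\<exists>s. t = a + s")
      case True
      then show ?thesis
        using False by (auto simp: lookup_single_mult_add lookup_free_poly)
    qed (simp add: lookup_single_mult_eq_0)
    moreover have "l (rmonom (a + (u - t))) = 0" if "t \<in> T"
    proof -
      have "a + (u - t) \<notin> B"
        using False T_of_standard[OF that, of a] by blast
      moreover have "Poly_Mapping.keys (a + (u - t)) \<subseteq> V"
        using a keys_u_diff[OF that] by (simp add: keys_add_nat)
      ultimately show ?thesis
        by (simp add: rmonom_eq_zero omegaD(3)[OF l])
    qed
    ultimately show ?thesis
      by (simp add: lookup_free_poly ev del: canonical_module_simps)
  qed
  show ?thesis
    using eq a free_poly_closed
    by (simp add: proj_mult proj_eq_iff single_in_mpoly_algebra mpoly_closed del: canonical_module_simps)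
qed

lemma free_poly_add:
  assumes "l \<in> carrier omega" "l' \<in> carrier omega"
  shows "free_poly (l \<oplus>\<^bsub>omega\<^esub> l') = free_poly l + free_poly l'"
  unfolding free_poly_def sum.distrib[symmetric]
  using rmonom_closed[OF keys_u_diff] by (intro sum.cong) (simp_all add: single_add)

text \<open>Both sides of the scalar law are additive in \<open>r\<close>, so it reduces to the case
  of a monomial scalar.\<close>

lemma free_hom: "(\<lambda>l\<in>carrier omega. proj (free_poly l)) \<in> module_hom A omega (regular_module A)"
    (is "?\<phi> \<in> _")
proof (rule module_homI)
  show "?\<phi> \<in> carrier omega \<rightarrow>\<^sub>E carrier (regular_module A)"
    by (auto simp: free_poly_closed)
  show phi_add: "?\<phi> (l \<oplus>\<^bsub>omega\<^esub> l') = ?\<phi> l \<oplus>\<^bsub>regular_module A\<^esub> ?\<phi> l'"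
    if "l \<in> carrier omega" "l' \<in> carrier omega" for l l'
    using that omega.M.a_closed[OF that]
    by (simp add: free_poly_add proj_add free_poly_closed del: canonical_module_simps)
  show "?\<phi> (r \<odot>\<^bsub>omega\<^esub> l) = r \<odot>\<^bsub>regular_module A\<^esub> ?\<phi> l"
    if "r \<in> carrier A" and l: "l \<in> carrier omega" for r l
    using \<open>r \<in> carrier A\<close>
  proof (induction rule: proj_induct)
    case (single a c)
    then have "proj (Poly_Mapping.single a c) \<odot>\<^bsub>omega\<^esub> l \<in> carrier omega"
      by (intro omega.smult_closed l proj_closed single_in_mpoly_algebra)
    then show ?case
      using l free_poly_smult_single[OF l single] by (simp del: canonical_module_simps)
  next
    case (add y z)
    have c: "y \<odot>\<^bsub>omega\<^esub> l \<in> carrier omega" "z \<odot>\<^bsub>omega\<^esub> l \<in> carrier omega"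
      using add(1,2) l by (auto intro: omega.smult_closed simp del: canonical_module_simps)
    have "?\<phi> l \<in> carrier A"
      using l by (simp add: free_poly_closed del: canonical_module_simps)
    then show ?case
      using add l phi_add[OF c]
      by (simp add: omega.smult_l_distr A.l_distr del: canonical_module_simps)
  qed
qed

lemma free_poly_dual: "proj (free_poly (dual (top_exponent G))) = residue_monom V \<Delta> n F"
proof -
  let ?q = "squarefree_exponent F" and ?t = "top_exponent G"
  have kq: "Poly_Mapping.keys ?q = F"
    using finite_face[OF F] by (rule keys_squarefree_exponent)
  \<comment> \<open>The exponents of \<open>x_F\<close> are at most 1 and
    \<open>n i \<ge> 2\<close>, so \<open>x_F\<close> is a standard monomial.\<close>
  have q: "?q \<in> T"
    using F finite_face[OF F] exponents kq
    by (auto simp: T_def standard_exponents_def lookup_squarefree_exponent less_le_trans[of _ 2])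
  have tB: "?t \<in> B"
    using G_face by (rule top_exponent_standard)
  have "dual ?t (rmonom (u - t)) = (if t = ?q then 1 else 0)" if "t \<in> T" for t
  proof -
    \<comment> \<open>As \<open>u\<close> is the exponent of \<open>x_F s\<^sub>G\<close>, the
      reflection hits \<open>s\<^sub>G\<close> exactly at \<open>x_F\<close>; only this term of
      \<open>free_poly\<close> survives.\<close>
    have "u - t = ?t \<longleftrightarrow> t = ?q"
    proof
      assume "u - t = ?t"
      then have "t + ?t = u"
        using le_exponent_add_diff[of t u] T_le_u[OF that] by simp
      then show "t = ?q"
        by (simp add: u_def add.commute)
    qed (simp add: u_def)
    then show ?thesis
      using keys_u_diff[OF that] tB
      by (simp add: dual_def rmonom_def single_in_mpoly_algebra coef_proj lookup_single when_def)
  qed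
  moreover have "residue_monom V \<Delta> n F = proj (Poly_Mapping.single ?q 1)"
    by (simp only: residue_monom_eq rmonom_def)
  ultimately show ?thesis
    using F face_subset kq q
    by (simp only:, subst proj_eq_iff) (auto simp: free_poly_closed single_in_mpoly_algebra lookup_free_poly lookup_single when_def)
qed

lemma residue_monom_in_trace_of_facet: "residue_monom V \<Delta> n F \<in> canonical_trace K A"
proof -
  have D: "dual (top_exponent G) \<in> carrier omega"
    by (intro dual_closed top_exponent_standard G_face)
  show ?thesis
    using module_trace_memI[OF A.M_cring free_hom D] D
    by (simp add: canonical_trace_def free_poly_dual del: canonical_module_simps)
qed

end

section \<open>Equality of the two ideals\<close>

lemma residue_monom_in_canonical_trace:
  assumes "free_face \<Delta> F"
  shows "residue_monom V \<Delta> n F \<in> canonical_trace K A"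
  using assms
proof (rule free_face_facet)
  fix G assume "facet \<Delta> G" "F \<subseteq> G" "\<And>H. H \<in> \<Delta> \<Longrightarrow> F \<subseteq> H \<Longrightarrow> H \<subseteq> G"
  \<comment> \<open>The two instances of \<open>refl\<close> discharge the defining equations of
    \<open>u\<close> and \<open>T\<close>.\<close>
  then show ?thesis
    using residue_monom_in_trace_of_facet[OF free_face_in_complex[OF assms] _ _ _ refl refl] by blast
qed

lemma canonical_trace_eq:
  assumes "flag_complex V \<Delta>"
  shows "canonical_trace K A = free_ideal"
proof
  show "free_ideal \<subseteq> canonical_trace K A"
    unfolding free_ideal_def
  proof (rule A.genideal_minimal)
    show "ideal (canonical_trace K A) A"
      unfolding canonical_trace_def by (rule module_trace_ideal) (rule omega.module_axioms)
  qed (auto intro: residue_monom_in_canonical_trace)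
qed (rule canonical_trace_subset[OF assms])

end

theorem theorem7p1:
  fixes m :: nat and \<Delta> :: "nat set set" and n :: "nat \<Rightarrow> nat"
    and A :: "('k::field, 'k mpoly set) module"
  assumes complex: "simplicial_complex_on {1..m} \<Delta>"
    and no_ghost: "\<forall>i\<in>{1..m}. \<not> ghost_vertex \<Delta> i"
    and exponents: "\<forall>i\<in>{1..m}. n i \<ge> 2"
    and A: "A = artinian_reduction {1..m} \<Delta> n"
    and flag: "flag_complex {1..m} \<Delta>"
  shows "canonical_trace (ring_of_type_algebra :: 'k ring) A
       = Idl\<^bsub>A\<^esub> {residue_monom {1..m} \<Delta> n F | F. free_face \<Delta> F}"
proof -
  interpret artinian_stanley_reisner "{1..m}" \<Delta> n A
    by unfold_locales (use complex exponents A in auto)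
  show ?thesis
    using canonical_trace_eq[OF flag] unfolding free_ideal_def .
qed

end
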